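(* Let $n\ge1$ and $k\in\mathbb Z^+$, and let $\lambda=(1^k)$ be the column shape of length $k$. Then $\mathbf{S}_{(1^k)}(n)=\mathbf{I}_k(n)$ in $\mathbf{U}(gl(n))$.
   Context: Virtual method. $gl(m_0|m_1+n)$ ($m_0,m_1$ sufficiently large) is the complex general linear Lie superalgebra with basis $e_{a,b}$, $a,b\in A_0\cup A_1\cup L$, $A_0=\{\alpha_1,\dots,\alpha_{m_0}\}$ (parity $0$), $A_1=\{\beta_1,\dots,\beta_{m_1}\}$ (parity $1$), $L=\{1,\dots,n\}$ (parity $1$), $|e_{a,b}|=|a|+|b|$, and $[e_{a,b},e_{c,d}]=\delta_{bc}e_{a,d}-(-1)^{(|a|+|b|)(|c|+|d|)}\delta_{ad}e_{c,b}$. Symbols in $A_0\cup A_1$ are virtual. $gl(n)$ is the subalgebra spanned by $e_{i,j}$, $i,j\in L$, so $\mathbf{U}(gl(n))\subset\mathbf{U}(gl(m_0|m_1+n))$. A product $e_{a_M,b_M}\cdots e_{a_1,b_1}$ is irregular if there are $i\le M$ and a virtual symbol $\gamma$ with $\#\{j\le i: b_j=\gamma\}>\#\{j<i: a_j=\gamma\}$. Let $\mathbf{Irr}$ be the left ideal of $\mathbf{U}(gl(m_0|m_1+n))$ generated by irregular products. The sum $Virt(m_0+m_1,n)=\mathbf{U}(gl(n))\oplus\mathbf{Irr}$ is direct and is a subalgebra in which $\mathbf{Irr}$ is a two-sided ideal; $\mathfrak p:Virt(m_0+m_1,n)\to\mathbf{U}(gl(n))$ is the projection with kernel $\mathbf{Irr}$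 (an algebra epimorphism). All monomials to which $\mathfrak p$ is applied here lie in $Virt(m_0+m_1,n)$. For two Young tableaux $S,T$ of the same shape $\lambda$, $e_{S,T}$ is the product of the $e_{s,t}$, $s,t$ being the entries of $S,T$ in the same cell, cells being read row by row from top to bottom and left to right. $C^*_\lambda$ has all entries in row $i$ equal to $\alpha_i$; $D^*_\lambda$ has all entries in column $j$ equal to $\beta_j$. $H(\lambda)$ is the product of the hook lengths of $\lambda$. For $\lambda_1\le n$, $$\mathbf{S}_\lambda(n)=\frac1{H(\lambda)}\sum_S\mathfrak p\big(e_{S,C^*_\lambda}\cdot e_{C^*_\lambda,D^*_\lambda}\cdot e_{D^*_\lambda,C^*_\lambda}\cdot e_{C^*_\lambda,S}\big),$$ over all tableaux $S$ of shape $\lambda$ on $\{1,\dots,n\}$ with strictly increasing rows. For $k\in\mathbb Z^+$ and any $\beta\in A_1$, $$\mathbf{I}_k(n)=\sum_{h_1+\cdots+h_n=k}\frac1{h_1!\cdots h_n!}\,\mathfrak p\big(e_{n,\beta}^{h_n}\cdots e_{1,\beta}^{h_1}e_{\beta,1}^{h_1}\cdots e_{\beta,n}^{h_n}\big),$$ the sum being over $n$-tuples of nonnegative integers. *)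

theory Defs
  imports "HOL-Algebra.QuotRing" "HOL-Algebra.Generated_Rings" "HOL-Library.Poly_Mapping" Complex_Main
begin

section \<open>Free associative algebras over the complex numbers\<close>

text \<open>Lists are turned into the free monoid under concatenation, so that finitely supported
  functions from lists to \<^typ>\<open>complex\<close>, with the convolution product of
  \<^theory>\<open>HOL-Library.Poly_Mapping\<close>, are the noncommutative polynomials.\<close>

instantiation list :: (type) monoid_add
begin

definition zero_list :: "'a list" where "zero_list = []"

definition plus_list :: "'a list \<Rightarrow> 'a list \<Rightarrow> 'a list" where "plus_list xs ys = xs @ ys"

instance by standard (simp_all add: zero_list_def plus_list_def)

end

definition free_algebra :: "'x set \<Rightarrow> ('x list \<Rightarrow>\<^sub>0 complex) ring" where
  "free_algebra B = \<lparr>carrier = {f. Poly_Mapping.keys f \<subseteq> lists B}, mult = (*), one = 1, zero = 0, add = (+)\<rparr>"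

abbreviation word :: "'x list \<Rightarrow> ('x list \<Rightarrow>\<^sub>0 complex)" where
  "word w \<equiv> Poly_Mapping.single w 1"

abbreviation const :: "complex \<Rightarrow> ('x list \<Rightarrow>\<^sub>0 complex)" where
  "const c \<equiv> Poly_Mapping.single [] c"


section \<open>The general linear Lie superalgebra and its enveloping algebra\<close>

text \<open>\<open>Alpha i\<close> and \<open>Beta i\<close> are the virtual symbols of parity 0 and 1, \<open>Letter i\<close> is the
  proper symbol \<open>i\<close>.\<close>

datatype symb = Alpha nat | Beta nat | Letter nat

fun parity :: "symb \<Rightarrow> nat" where
  "parity (Alpha i) = 0"
| "parity (Beta i) = 1"
| "parity (Letter i) = 1"

definition A0 :: "nat \<Rightarrow> symb set" where "A0 m0 = Alpha ` {1..m0}"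
definition A1 :: "nat \<Rightarrow> symb set" where "A1 m1 = Beta ` {1..m1}"
definition Lset :: "nat \<Rightarrow> symb set" where "Lset n = Letter ` {1..n}"

text \<open>The basis element \<open>e\<^sub>a\<^sub>,\<^sub>b\<close> of \<open>gl(m0|m1+n)\<close> is represented by the pair \<open>(a, b)\<close>.\<close>

definition gl_basis :: "nat \<Rightarrow> nat \<Rightarrow> nat \<Rightarrow> (symb \<times> symb) set" where
  "gl_basis m0 m1 n = (A0 m0 \<union> A1 m1 \<union> Lset n) \<times> (A0 m0 \<union> A1 m1 \<union> Lset n)"

definition gl_sign :: "symb \<times> symb \<Rightarrow> symb \<times> symb \<Rightarrow> complex" where
  "gl_sign x y = (-1) ^ ((parity (fst x) + parity (snd x)) * (parity (fst y) + parity (snd y)))"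

text \<open>The superbracket of two basis elements, as a linear polynomial in the basis elements.\<close>

definition gl_bracket :: "symb \<times> symb \<Rightarrow> symb \<times> symb \<Rightarrow> ((symb \<times> symb) list \<Rightarrow>\<^sub>0 complex)" where
  "gl_bracket x y =
     (if snd x = fst y then word [(fst x, snd y)] else 0)
     - const (gl_sign x y) * (if fst x = snd y then word [(fst y, snd x)] else 0)"

definition gl_relations :: "nat \<Rightarrow> nat \<Rightarrow> nat \<Rightarrow> ((symb \<times> symb) list \<Rightarrow>\<^sub>0 complex) set" where
  "gl_relations m0 m1 n =
     {word [x] * word [y] - const (gl_sign x y) * (word [y] * word [x]) - gl_bracket x y | x y.
        x \<in> gl_basis m0 m1 n \<and> y \<in> gl_basis m0 m1 n}"

definition gl_ideal :: "nat \<Rightarrow> nat \<Rightarrow> nat \<Rightarrow> ((symb \<times> symb) list \<Rightarrow>\<^sub>0 complex) set" where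
  "gl_ideal m0 m1 n = Idl\<^bsub>free_algebra (gl_basis m0 m1 n)\<^esub> (gl_relations m0 m1 n)"

type_synonym env = "((symb \<times> symb) list \<Rightarrow>\<^sub>0 complex) set"

definition Ugl :: "nat \<Rightarrow> nat \<Rightarrow> nat \<Rightarrow> env ring" where
  "Ugl m0 m1 n = free_algebra (gl_basis m0 m1 n) Quot gl_ideal m0 m1 n"

definition Ucls :: "nat \<Rightarrow> nat \<Rightarrow> nat \<Rightarrow> ((symb \<times> symb) list \<Rightarrow>\<^sub>0 complex) \<Rightarrow> env" where
  "Ucls m0 m1 n f = gl_ideal m0 m1 n +>\<^bsub>free_algebra (gl_basis m0 m1 n)\<^esub> f"

text \<open>\<open>Uprod m0 m1 n [(a\<^sub>M, b\<^sub>M), \<dots>, (a\<^sub>1, b\<^sub>1)]\<close> is the product of the \<open>e\<close>'s in the written order;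
  by definition of the free algebra it is the class of the word itself.\<close>

definition Uprod :: "nat \<Rightarrow> nat \<Rightarrow> nat \<Rightarrow> (symb \<times> symb) list \<Rightarrow> env" where
  "Uprod m0 m1 n w = Ucls m0 m1 n (word w)"

definition Uscale :: "nat \<Rightarrow> nat \<Rightarrow> nat \<Rightarrow> complex \<Rightarrow> env \<Rightarrow> env" where
  "Uscale m0 m1 n c u = Ucls m0 m1 n (const c) \<otimes>\<^bsub>Ugl m0 m1 n\<^esub> u"

text \<open>\<open>U(gl(n))\<close>, identified as usual with the unital complex subalgebra generated by the
  \<open>e\<^sub>i\<^sub>,\<^sub>j\<close> with \<open>i, j\<close> proper.\<close>

definition Ugl_proper :: "nat \<Rightarrow> nat \<Rightarrow> nat \<Rightarrow> env set" where
  "Ugl_proper m0 m1 n = generate_ring (Ugl m0 m1 n)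
     (range (\<lambda>c. Ucls m0 m1 n (const c)) \<union> {Uprod m0 m1 n [(i, j)] | i j. i \<in> Lset n \<and> j \<in> Lset n})"


section \<open>The virtual method\<close>

text \<open>The word \<open>[(a\<^sub>M, b\<^sub>M), \<dots>, (a\<^sub>1, b\<^sub>1)]\<close> is scanned from right to left, hence the reversal;
  positions are counted from 0.\<close>

definition irregular :: "nat \<Rightarrow> nat \<Rightarrow> (symb \<times> symb) list \<Rightarrow> bool" where
  "irregular m0 m1 w \<longleftrightarrow>
     (\<exists>i < length w. \<exists>\<gamma> \<in> A0 m0 \<union> A1 m1.
        card {j. j \<le> i \<and> snd (rev w ! j) = \<gamma>} > card {j. j < i \<and> fst (rev w ! j) = \<gamma>})"

definition left_ideal :: "'a set \<Rightarrow> ('a, 'b) ring_scheme \<Rightarrow> bool" where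
  "left_ideal I R \<longleftrightarrow> additive_subgroup I R \<and> (\<forall>r \<in> carrier R. \<forall>x \<in> I. r \<otimes>\<^bsub>R\<^esub> x \<in> I)"

definition Irr :: "nat \<Rightarrow> nat \<Rightarrow> nat \<Rightarrow> env set" where
  "Irr m0 m1 n = \<Inter>{I. left_ideal I (Ugl m0 m1 n) \<and>
     {Uprod m0 m1 n w | w. w \<in> lists (gl_basis m0 m1 n) \<and> irregular m0 m1 w} \<subseteq> I}"

definition Virt :: "nat \<Rightarrow> nat \<Rightarrow> nat \<Rightarrow> env set" where
  "Virt m0 m1 n = Ugl_proper m0 m1 n <+>\<^bsub>Ugl m0 m1 n\<^esub> Irr m0 m1 n"

text \<open>The projection of \<open>Virt\<close> onto \<open>U(gl(n))\<close> along \<open>Irr\<close>; the description is proper because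
  \<open>U(gl(n))\<close> and \<open>Irr\<close> intersect trivially.\<close>

definition vproj :: "nat \<Rightarrow> nat \<Rightarrow> nat \<Rightarrow> env \<Rightarrow> env" where
  "vproj m0 m1 n = restrict
     (\<lambda>x. THE u. u \<in> Ugl_proper m0 m1 n \<and> x \<ominus>\<^bsub>Ugl m0 m1 n\<^esub> u \<in> Irr m0 m1 n) (Virt m0 m1 n)"


section \<open>Tableaux and hook lengths\<close>

text \<open>A shape is the list of its row lengths and a tableau the list of its rows.\<close>

definition tab_word :: "symb list list \<Rightarrow> symb list list \<Rightarrow> (symb \<times> symb) list" where
  "tab_word S T = zip (concat S) (concat T)"

definition C_star :: "nat list \<Rightarrow> symb list list" where
  "C_star lam = map (\<lambda>i. replicate (lam ! i) (Alpha (i + 1))) [0..<length lam]"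

definition D_star :: "nat list \<Rightarrow> symb list list" where
  "D_star lam = map (\<lambda>r. map Beta [1..<r + 1]) lam"

definition row_strict_tableaux :: "nat \<Rightarrow> nat list \<Rightarrow> nat list list set" where
  "row_strict_tableaux n lam =
     {S. map length S = lam \<and> (\<forall>row \<in> set S. set row \<subseteq> {1..n} \<and> sorted_wrt (<) row)}"

text \<open>Cells \<open>(i, j)\<close> are counted from 0, so the hook length (arm + leg + 1) is
  \<open>(\<lambda>\<^sub>i - j) + (\<lambda>'\<^sub>j - i) - 1\<close>, where \<open>\<lambda>'\<close> is the conjugate shape.\<close>

definition hook_length :: "nat list \<Rightarrow> nat \<Rightarrow> nat \<Rightarrow> nat" where
  "hook_length lam i j = (lam ! i - j) + (card {r. r < length lam \<and> j < lam ! r} - i) - 1"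

definition hook_product :: "nat list \<Rightarrow> nat" where
  "hook_product lam = (\<Prod>i<length lam. \<Prod>j<lam ! i. hook_length lam i j)"


section \<open>The elements \<open>S\<^sub>\<lambda>(n)\<close> and \<open>I\<^sub>k(n)\<close>\<close>

definition S_elem :: "nat \<Rightarrow> nat \<Rightarrow> nat \<Rightarrow> nat list \<Rightarrow> env" where
  "S_elem m0 m1 n lam =
     Uscale m0 m1 n (1 / of_nat (hook_product lam))
       (\<Oplus>\<^bsub>Ugl m0 m1 n\<^esub> T \<in> row_strict_tableaux n lam.
          (let S = map (map Letter) T; C = C_star lam; D = D_star lam in
           vproj m0 m1 n
             (Uprod m0 m1 n (tab_word S C) \<otimes>\<^bsub>Ugl m0 m1 n\<^esub> Uprod m0 m1 n (tab_word C D)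
              \<otimes>\<^bsub>Ugl m0 m1 n\<^esub> Uprod m0 m1 n (tab_word D C) \<otimes>\<^bsub>Ugl m0 m1 n\<^esub> Uprod m0 m1 n (tab_word C S))))"

text \<open>The tuple \<open>(h\<^sub>1, \<dots>, h\<^sub>n)\<close> is a list, so \<open>h\<^sub>i\<close> is \<open>h ! (i - 1)\<close>.\<close>

definition I_elem :: "nat \<Rightarrow> nat \<Rightarrow> nat \<Rightarrow> symb \<Rightarrow> nat \<Rightarrow> env" where
  "I_elem m0 m1 n \<beta> k =
     (\<Oplus>\<^bsub>Ugl m0 m1 n\<^esub> h \<in> {h :: nat list. length h = n \<and> sum_list h = k}.
        Uscale m0 m1 n (1 / (\<Prod>i = 1..n. fact (h ! (i - 1))))
          (vproj m0 m1 n
            (Uprod m0 m1 n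
              (concat (map (\<lambda>i. replicate (h ! (i - 1)) (Letter i, \<beta>)) (rev [1..<n + 1]))
               @ concat (map (\<lambda>i. replicate (h ! (i - 1)) (\<beta>, Letter i)) [1..<n + 1])))))"


section \<open>Well-formedness\<close>

lemma ring_free_algebra: "ring (free_algebra B)"
proof -
  have mult: "Poly_Mapping.keys (f * g) \<subseteq> lists B"
    if "Poly_Mapping.keys f \<subseteq> lists B" "Poly_Mapping.keys g \<subseteq> lists B"
    for f g :: "'a list \<Rightarrow>\<^sub>0 complex"
    using keys_mult[of f g] that by (fastforce simp: plus_list_def)
  have add: "Poly_Mapping.keys (f + g) \<subseteq> lists B"
    if "Poly_Mapping.keys f \<subseteq> lists B" "Poly_Mapping.keys g \<subseteq> lists B"
    for f g :: "'a list \<Rightarrow>\<^sub>0 complex"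
    using Poly_Mapping.keys_add[of f g] that by blast
  have one: "Poly_Mapping.keys (1 :: 'a list \<Rightarrow>\<^sub>0 complex) \<subseteq> lists B"
    by (simp add: zero_list_def)
  show ?thesis
  proof (rule ringI)
    show "abelian_group (free_algebra B)"
    proof (rule abelian_groupI)
      fix f assume "f \<in> carrier (free_algebra B)"
      then show "\<exists>g\<in>carrier (free_algebra B). g \<oplus>\<^bsub>free_algebra B\<^esub> f = \<zero>\<^bsub>free_algebra B\<^esub>"
        by (intro bexI[of _ "- f"]) (auto simp: free_algebra_def)
    qed (use add in \<open>auto simp: free_algebra_def algebra_simps\<close>)
    show "monoid (free_algebra B)"
      by (rule monoidI) (use mult one in \<open>auto simp: free_algebra_def algebra_simps\<close>)
  qed (auto simp: free_algebra_def algebra_simps)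
qed

lemma gl_relations_carrier:
  "gl_relations m0 m1 n \<subseteq> carrier (free_algebra (gl_basis m0 m1 n))"
proof -
  let ?B = "gl_basis m0 m1 n"
  define P where "P f \<longleftrightarrow> Poly_Mapping.keys f \<subseteq> lists ?B" for f :: "(symb \<times> symb) list \<Rightarrow>\<^sub>0 complex"
  have minus: "P (f - g)" if "P f" "P g" for f g
    using keys_diff[of f g] that unfolding P_def by blast
  have mult: "P (f * g)" if "P f" "P g" for f g
    using keys_mult[of f g] that unfolding P_def by (fastforce simp: plus_list_def)
  have const: "P (const c)" for c unfolding P_def by (auto split: if_splits)
  have gen: "P (word [x])" if "x \<in> ?B" for x using that unfolding P_def by auto
  have zero: "P 0" unfolding P_def by simp
  have "P (word [x] * word [y] - const (gl_sign x y) * (word [y] * word [x]) - gl_bracket x y)"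
    if "x \<in> ?B" "y \<in> ?B" for x y
  proof -
    have "(fst x, snd y) \<in> ?B" "(fst y, snd x) \<in> ?B"
      using that by (auto simp: gl_basis_def)
    then show ?thesis
      unfolding gl_bracket_def using that
      by (intro minus mult const gen) (auto intro: gen zero)
  qed
  then have "gl_relations m0 m1 n \<subseteq> Collect P" unfolding gl_relations_def by blast
  then show ?thesis by (simp add: free_algebra_def P_def[abs_def])
qed

lemma ring_Ugl: "ring (Ugl m0 m1 n)"
proof -
  interpret ring "free_algebra (gl_basis m0 m1 n)" by (rule ring_free_algebra)
  show ?thesis
    unfolding Ugl_def gl_ideal_def
    by (rule ideal.quotient_is_ring[OF genideal_ideal[OF gl_relations_carrier]])
qed

end

theory Submission
  imports Defs "HOL-Combinatorics.Multiset_Permutations"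
begin

text \<open>Modulo the left ideal \<open>Irr\<close>, moving an annihilator \<open>e\<^sub>a\<^sub>,\<^sub>\<alpha>\<close> to the right past its creator
  \<open>e\<^sub>\<alpha>\<^sub>,\<^sub>c\<close> leaves only \<open>e\<^sub>a\<^sub>,\<^sub>c\<close>. Hence both halves of the monomial of a column tableau with entries
  \<open>s\<^sub>1, \<dots>, s\<^sub>k\<close> contract, with the same sign, and what is left is
  \<open>e\<^sub>s\<^sub>1\<^sub>,\<^sub>\<beta> \<dots> e\<^sub>s\<^sub>k\<^sub>,\<^sub>\<beta> e\<^sub>\<beta>\<^sub>,\<^sub>s\<^sub>1 \<dots> e\<^sub>\<beta>\<^sub>,\<^sub>s\<^sub>k\<close>, whose factors on either side of the middle commute. So the
  summand depends only on the multiplicities \<open>h\<^sub>i\<close> of \<open>i\<close> in \<open>s\<close>, and \<open>k! / (h\<^sub>1! \<dots> h\<^sub>n!)\<close> sequences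
  share them.

  That \<open>U(gl(n))\<close> meets \<open>Irr\<close> trivially, so that the projection is well defined, is seen on a
  module. Let \<open>x\<^sub>c\<^sub>,\<^sub>t\<close> generate a free superalgebra on which \<open>e\<^sub>a\<^sub>,\<^sub>b\<close> acts as the superderivation
  \<open>x\<^sub>c\<^sub>,\<^sub>t \<mapsto> \<delta>\<^sub>b\<^sub>,\<^sub>c x\<^sub>a\<^sub>,\<^sub>t\<close>. Irregular products kill everything without virtual variables, while on
  products of the shifted variables \<open>x\<^sub>j\<^sub>,\<^sub>i - \<delta>\<^sub>i\<^sub>,\<^sub>j\<close>, evaluated at \<open>x = 1\<close>, the leading terms of
  ordered monomials in \<open>e\<^sub>i\<^sub>,\<^sub>j\<close> are separated.\<close>

section \<open>The action on the shifted free superalgebra\<close>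

text \<open>\<open>dact x \<phi> v = \<phi> (e\<^sub>x v)\<close>: the action is transposed to functions on words, which avoids formal
  sums. The pair \<open>(c, t)\<close> stands for \<open>x\<^sub>c\<^sub>,\<^sub>t - \<delta>\<^sub>c\<^sub>,\<^sub>t\<close>, whence the second summand, and has parity
  \<open>|c| + 1\<close>, so that the constants \<open>\<delta>\<^sub>c\<^sub>,\<^sub>t\<close> (\<open>c\<close> proper) are even.\<close>

fun dact :: "symb \<times> symb \<Rightarrow> ((symb \<times> nat) list \<Rightarrow> complex) \<Rightarrow> (symb \<times> nat) list \<Rightarrow> complex" where
  "dact x \<phi> [] = 0"
| "dact x \<phi> (p # v) =
     (if fst p = snd x
      then \<phi> ((fst x, snd p) # v) + (if fst x = Letter (snd p) then \<phi> v else 0) else 0)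
     + (-1) ^ ((parity (fst x) + parity (snd x)) * (parity (fst p) + 1)) * dact x (\<lambda>v'. \<phi> (p # v')) v"

lemma dact_add: "dact x (\<lambda>v. \<phi> v + \<psi> v) v = dact x \<phi> v + dact x \<psi> v"
  by (induction v arbitrary: \<phi> \<psi>) (simp_all add: algebra_simps)

lemma dact_scale: "dact x (\<lambda>v. a * \<phi> v) v = a * dact x \<phi> v"
  by (induction v arbitrary: \<phi>) (simp_all add: algebra_simps)

lemma dact_zero: "dact x (\<lambda>v. 0) v = 0"
  using dact_scale[of x 0 "\<lambda>_. 0"] by simp

lemma parity_cases: "parity a = 0 \<or> parity a = 1"
  by (cases a) auto

text \<open>Both operators are superderivations, so the terms in which they act on different letters
  cancel up to the sign of the bracket; what survives is one hitting the letter produced by the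
  other. Composition is reversed because the action is transposed:
  \<open>dact y (dact x \<phi>) v\<close> is \<open>\<phi> (e_x (e_y v))\<close>.\<close>

lemma dact_commutator:
  "dact y (dact x \<phi>) v - gl_sign x y * dact x (dact y \<phi>) v =
     (if snd x = fst y then dact (fst x, snd y) \<phi> v else 0)
     - gl_sign x y * (if fst x = snd y then dact (fst y, snd x) \<phi> v else 0)"
proof (induction v arbitrary: \<phi>)
  case Nil
  then show ?case by simp
next
  case (Cons p v)
  \<comment> \<open>\<open>s\<close> is the sign for passing the head \<open>p\<close>,
    \<open>d\<close> tests whether the head is hit, \<open>l\<close> whether the shift contributes;
    \<open>T\<close> collects everything that hitting the head produces.\<close>
  define s where "s x = (-1 :: complex) ^ ((parity (fst x) + parity (snd x)) * (parity (fst p) + 1))" for x :: "symb \<times> symb"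
  define d where "d x = (if fst p = snd x then 1 else 0 :: complex)" for x :: "symb \<times> symb"
  define l where "l x = (if fst x = Letter (snd p) then 1 else 0 :: complex)" for x :: "symb \<times> symb"
  define T where "T x \<phi> = (\<lambda>v'. \<phi> ((fst x, snd p) # v') + l x * \<phi> v')"
    for x :: "symb \<times> symb" and \<phi> :: "(symb \<times> nat) list \<Rightarrow> complex"
  have *: "(\<lambda>v'. dact x \<phi> (p # v')) = (\<lambda>v'. d x * T x \<phi> v' + s x * dact x (\<lambda>v''. \<phi> (p # v'')) v')" for x \<phi>
    by (auto simp: fun_eq_iff s_def d_def l_def T_def)
  have **: "dact y (dact x \<phi>) (p # v) = d y * T y (dact x \<phi>) v
     + s y * (d x * dact y (T x \<phi>) v + s x * dact y (dact x (\<lambda>v''. \<phi> (p # v''))) v)" for x y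
    by (subst fun_cong[OF *]) (simp only: * dact_add dact_scale)
  define sq where "sq x q = (-1 :: complex) ^ ((parity (fst x) + parity (snd x)) * (parity q + 1))" for x :: "symb \<times> symb" and q
  have T: "T y (dact x \<phi>) v = (if fst y = snd x then T x \<phi> v else 0)
      + sq x (fst y) * dact x (\<lambda>v''. \<phi> ((fst y, snd p) # v'')) v + l y * dact x \<phi> v" for x y
    by (simp add: T_def sq_def l_def)
  have T': "dact y (T x \<phi>) v = dact y (\<lambda>v''. \<phi> ((fst x, snd p) # v'')) v + l x * dact y \<phi> v" for x y
    by (simp add: T_def dact_add dact_scale)
  have g: "gl_sign y x = gl_sign x y" "gl_sign x y * gl_sign x y = 1" for x y
    by (simp_all add: gl_sign_def mult.commute flip: power_mult_distrib)
  define e where "e x y = (if fst y = snd x then 1 else 0 :: complex)" for x y :: "symb \<times> symb"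
  have 1: "d y * T y (dact x \<phi>) v - gl_sign x y * s x * d y * dact x (T y \<phi>) v
      = d y * e x y * T x \<phi> v" for x y
  proof -
    have A1: "d y * sq x (fst y) = gl_sign x y * s x * d y"
      unfolding d_def sq_def gl_sign_def s_def
      using parity_cases[of "fst x"] parity_cases[of "snd x"] parity_cases[of "fst y"] parity_cases[of "snd y"]
      by auto
    \<comment> \<open>The shift term drops the letter. As \<open>fst y\<close> is a
      \<open>Letter\<close>, the head has the same parity as \<open>y\<close>, so
      \<open>gl_sign x y\<close> and \<open>s x\<close> agree and cancel; the parity
      \<open>|c| + 1\<close> is chosen for this.\<close>
    have A2: "d y * l y = gl_sign x y * s x * d y * l y"
      unfolding d_def l_def gl_sign_def s_def
      using parity_cases[of "fst x"] parity_cases[of "snd x"] parity_cases[of "snd y"]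
      by auto
    have "d y * T y (dact x \<phi>) v = d y * e x y * T x \<phi> v
      + (d y * sq x (fst y)) * dact x (\<lambda>v''. \<phi> ((fst y, snd p) # v'')) v + (d y * l y) * dact x \<phi> v"
      by (simp add: T e_def algebra_simps)
    then show ?thesis
      unfolding A1 T' by (subst (asm) A2) (simp add: algebra_simps)
  qed
  \<comment> \<open>Fact \<open>1\<close> with \<open>x\<close> and \<open>y\<close> exchanged,
    multiplied by \<open>- gl_sign x y\<close>.\<close>
  have 2: "s y * d x * dact y (T x \<phi>) v - gl_sign x y * d x * T x (dact y \<phi>) v
      = - gl_sign x y * d x * e y x * T y \<phi> v"
  proof -
    have gg: "gl_sign y x * (gl_sign y x * a) = a" for a
      using g(2)[of y x] by (metis mult.assoc mult_1)
    show ?thesis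
      using arg_cong[OF 1[of x y], of "\<lambda>z. - gl_sign x y * z"] g(1)[of x y]
      by (simp add: algebra_simps gg)
  qed
  have 3: "s y * s x * dact y (dact x (\<lambda>v''. \<phi> (p # v''))) v - gl_sign x y * (s x * s y * dact x (dact y (\<lambda>v''. \<phi> (p # v''))) v)
     = s x * s y * (e x y * dact (fst x, snd y) (\<lambda>v''. \<phi> (p # v'')) v
       - gl_sign x y * e y x * dact (fst y, snd x) (\<lambda>v''. \<phi> (p # v'')) v)"
    using arg_cong[OF Cons[of "\<lambda>v''. \<phi> (p # v'')"], of "\<lambda>z. s x * s y * z"]
    by (simp add: e_def algebra_simps split: if_splits)
  have s2: "e x y * s (fst x, snd y) = e x y * (s x * s y)" for x y
    unfolding e_def s_def
    using parity_cases[of "fst x"] parity_cases[of "snd x"] parity_cases[of "snd y"] parity_cases[of "fst p"]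
    by auto
  have 4: "(if snd x = fst y then dact (fst x, snd y) \<phi> (p # v) else 0)
     = d y * e x y * T x \<phi> v + s x * s y * e x y * dact (fst x, snd y) (\<lambda>v''. \<phi> (p # v'')) v" for x y
  proof -
    have "(if snd x = fst y then dact (fst x, snd y) \<phi> (p # v) else 0)
      = d y * e x y * T x \<phi> v + (e x y * s (fst x, snd y)) * dact (fst x, snd y) (\<lambda>v''. \<phi> (p # v'')) v"
      by (auto simp: e_def d_def T_def s_def l_def)
    then show ?thesis by (simp add: s2)
  qed
  have 5: "(if fst x = snd y then dact (fst y, snd x) \<phi> (p # v) else 0)
     = d x * e y x * T y \<phi> v + s x * s y * e y x * dact (fst y, snd x) (\<lambda>v''. \<phi> (p # v'')) v"
    using 4[of y x] by (simp add: eq_commute mult.commute mult.left_commute)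
  show ?case
    unfolding 4 5 ** using 1[of y x] 2 3 by (simp add: algebra_simps)
qed

section \<open>Noncommutative polynomials and their transposed action\<close>

lemma word_mult: "word u * word v = word (u @ v)"
  by (simp add: mult_single plus_list_def)

lemma const_mult_single: "const c * Poly_Mapping.single w a = Poly_Mapping.single w (c * a)"
  by (simp add: mult_single plus_list_def)

lemma free_algebra_expand: "f = (\<Sum>w\<in>Poly_Mapping.keys f. const (Poly_Mapping.lookup f w) * word w)"
proof (rule poly_mapping_eqI)
  fix w
  have "Poly_Mapping.lookup (\<Sum>w\<in>Poly_Mapping.keys f. const (Poly_Mapping.lookup f w) * word w) w
     = (\<Sum>u\<in>Poly_Mapping.keys f. if u = w then Poly_Mapping.lookup f w else 0)"
    unfolding lookup_sum by (intro sum.cong) (auto simp: const_mult_single lookup_single)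
  also have "\<dots> = Poly_Mapping.lookup f w"
    by (simp add: in_keys_iff)
  finally show "Poly_Mapping.lookup f w = Poly_Mapping.lookup (\<Sum>w\<in>Poly_Mapping.keys f. const (Poly_Mapping.lookup f w) * word w) w" ..
qed

text \<open>Restricting \<open>single\<close> to words that occur in \<open>f\<close> lets an
  induction use that \<open>f\<close> is a polynomial over a given alphabet.\<close>

lemma free_algebra_induct [case_names zero single add]:
  assumes "P 0"
    and "\<And>w c. w \<in> Poly_Mapping.keys f \<Longrightarrow> P (const c * word w)"
    and "\<And>f g. P f \<Longrightarrow> P g \<Longrightarrow> P (f + g)"
  shows "P (f :: 'x list \<Rightarrow>\<^sub>0 complex)"
proof -
  have "P (\<Sum>w\<in>S. const (Poly_Mapping.lookup f w) * word w)"
    if "finite S" "S \<subseteq> Poly_Mapping.keys f" for S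
    using that by (induction S rule: finite_induct) (auto intro: assms)
  then show ?thesis
    by (subst free_algebra_expand) auto
qed

lemma const_commute: "f * const c = const c * (f :: 'x list \<Rightarrow>\<^sub>0 complex)"
proof (induction f rule: free_algebra_induct)
  case (single w a)
  show ?case by (simp add: mult_single plus_list_def mult.commute)
qed (simp_all add: distrib_left distrib_right)

text \<open>The first factor of a product acts last on a vector, hence first on the functional;
  \<open>dact_poly\<close> therefore reverses products.\<close>

primrec dact_word :: "(symb \<times> symb) list \<Rightarrow> ((symb \<times> nat) list \<Rightarrow> complex) \<Rightarrow> (symb \<times> nat) list \<Rightarrow> complex" where
  "dact_word [] \<phi> = \<phi>"
| "dact_word (x # w) \<phi> = dact_word w (dact x \<phi>)"

lemma dact_word_append: "dact_word (u @ w) \<phi> = dact_word w (dact_word u \<phi>)"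
  by (induction u arbitrary: \<phi>) auto

lemma dact_word_add: "dact_word w (\<lambda>v. \<phi> v + \<psi> v) = (\<lambda>v. dact_word w \<phi> v + dact_word w \<psi> v)"
  by (induction w arbitrary: \<phi> \<psi>) (simp_all add: dact_add[abs_def])

lemma dact_word_scale: "dact_word w (\<lambda>v. a * \<phi> v) = (\<lambda>v. a * dact_word w \<phi> v)"
  by (induction w arbitrary: \<phi>) (simp_all add: dact_scale[abs_def])

lemma dact_word_zero: "dact_word w (\<lambda>v. 0) = (\<lambda>v. 0)"
  by (induction w) (simp_all add: dact_zero[abs_def])

definition dact_poly :: "((symb \<times> symb) list \<Rightarrow>\<^sub>0 complex) \<Rightarrow> ((symb \<times> nat) list \<Rightarrow> complex) \<Rightarrow> (symb \<times> nat) list \<Rightarrow> complex" where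
  "dact_poly f \<phi> v = (\<Sum>w\<in>Poly_Mapping.keys f. Poly_Mapping.lookup f w * dact_word w \<phi> v)"

lemma dact_poly_superset:
  assumes "finite S" "Poly_Mapping.keys f \<subseteq> S"
  shows "dact_poly f \<phi> v = (\<Sum>w\<in>S. Poly_Mapping.lookup f w * dact_word w \<phi> v)"
  unfolding dact_poly_def by (rule sum.mono_neutral_left) (use assms in \<open>auto simp: in_keys_iff\<close>)

lemma dact_poly_plus: "dact_poly (f + g) \<phi> = (\<lambda>v. dact_poly f \<phi> v + dact_poly g \<phi> v)"
proof
  fix v
  have "finite (Poly_Mapping.keys f \<union> Poly_Mapping.keys g)" by simp
  then show "dact_poly (f + g) \<phi> v = dact_poly f \<phi> v + dact_poly g \<phi> v"
    by (subst (1 2 3) dact_poly_superset[where S = "Poly_Mapping.keys f \<union> Poly_Mapping.keys g"])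
      (use Poly_Mapping.keys_add[of f g] in \<open>auto simp: lookup_add algebra_simps sum.distrib\<close>)
qed

lemma dact_poly_single: "dact_poly (Poly_Mapping.single w c) \<phi> = (\<lambda>v. c * dact_word w \<phi> v)"
  by (auto simp: dact_poly_def fun_eq_iff)

lemma dact_poly_0: "dact_poly 0 \<phi> = (\<lambda>v. 0)"
  by (simp add: dact_poly_def fun_eq_iff)

lemma dact_poly_uminus: "dact_poly (- f) \<phi> = (\<lambda>v. - dact_poly f \<phi> v)"
  by (simp add: dact_poly_def fun_eq_iff sum_negf)

lemma dact_poly_minus: "dact_poly (f - g) \<phi> = (\<lambda>v. dact_poly f \<phi> v - dact_poly g \<phi> v)"
  using dact_poly_plus[of f "- g" \<phi>] by (simp add: dact_poly_uminus)

lemma dact_poly_add_arg: "dact_poly f (\<lambda>v. \<phi> v + \<psi> v) = (\<lambda>v. dact_poly f \<phi> v + dact_poly f \<psi> v)"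
  by (simp add: dact_poly_def dact_word_add fun_eq_iff algebra_simps sum.distrib)

lemma dact_poly_zero_arg: "dact_poly f (\<lambda>v. 0) = (\<lambda>v. 0)"
  by (simp add: dact_poly_def dact_word_zero fun_eq_iff)

lemma dact_poly_mult: "dact_poly (f * g) \<phi> = dact_poly g (dact_poly f \<phi>)"
proof (induction f rule: free_algebra_induct)
  case zero
  then show ?case by (simp add: dact_poly_0 dact_poly_zero_arg)
next
  case (single w c)
  show ?case
  proof (induction g rule: free_algebra_induct)
    case (single u d)
    show ?case
      by (simp add: mult_single plus_list_def dact_poly_single dact_word_append dact_word_scale fun_eq_iff)
  qed (simp_all add: dact_poly_0 distrib_left dact_poly_plus)
next
  case (add f1 f2)
  then show ?case
    by (simp add: distrib_right dact_poly_plus dact_poly_add_arg)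
qed

lemma dact_poly_relation:
  "dact_poly (word [x] * word [y] - const (gl_sign x y) * (word [y] * word [x]) - gl_bracket x y) \<phi> v = 0"
  using dact_commutator[of y x \<phi> v]
  by (auto simp: gl_bracket_def dact_poly_minus dact_poly_mult dact_poly_single dact_poly_0 dact_scale dact_scale[abs_def])

section \<open>Virtual symbols and irregular words\<close>

abbreviation occ :: "('a \<Rightarrow> symb) \<Rightarrow> symb \<Rightarrow> 'a list \<Rightarrow> nat" where
  "occ p \<gamma> v \<equiv> length (filter (\<lambda>x. p x = \<gamma>) v)"

text \<open>Only words \<open>v'\<close> with the displayed balance occur in \<open>e_x v\<close>:
  the letter that is hit trades one \<open>snd x\<close> for one \<open>fst x\<close>. The shift
  term drops a letter only where the new symbol would be proper; \<gamma> is not proper, so the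
  balance persists.\<close>

lemma dact_eq_0_occ:
  assumes "\<And>v'. occ fst \<gamma> v' + of_bool (snd x = \<gamma>) = occ fst \<gamma> v + of_bool (fst x = \<gamma>) \<Longrightarrow> \<psi> v' = 0"
    and "\<And>i. \<gamma> \<noteq> Letter i"
  shows "dact x \<psi> v = 0"
  using assms(1)
proof (induction v arbitrary: \<psi>)
  case (Cons p v)
  have "dact x (\<lambda>v'. \<psi> (p # v')) v = 0"
    by (rule Cons.IH) (auto intro: Cons.prems)
  moreover have "\<psi> ((fst x, snd p) # v) = 0" if "fst p = snd x"
    by (rule Cons.prems) (use that in auto)
  moreover have "\<psi> v = 0" if "fst p = snd x" "fst x = Letter (snd p)"
    by (rule Cons.prems) (use that assms(2)[of "snd p"] in auto)
  ultimately show ?case by simp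
qed simp

lemma dact_word_eq_0_occ:
  assumes "\<And>v'. occ fst \<gamma> v' + occ snd \<gamma> w = occ fst \<gamma> v + occ fst \<gamma> w \<Longrightarrow> \<psi> v' = 0"
    and "\<And>i. \<gamma> \<noteq> Letter i"
  shows "dact_word w \<psi> v = 0"
  using assms(1)
proof (induction w arbitrary: \<psi>)
  case (Cons x w)
  have "dact_word w (dact x \<psi>) v = 0"
  proof (rule Cons.IH)
    fix v' :: "(symb \<times> nat) list" assume *: "occ fst \<gamma> v' + occ snd \<gamma> w = occ fst \<gamma> v + occ fst \<gamma> w"
    show "dact x \<psi> v' = 0"
    proof (rule dact_eq_0_occ[OF _ assms(2)])
      fix v'' :: "(symb \<times> nat) list" assume "occ fst \<gamma> v'' + of_bool (snd x = \<gamma>) = occ fst \<gamma> v' + of_bool (fst x = \<gamma>)"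
      then show "\<psi> v'' = 0"
        using * by (intro Cons.prems) (auto split: if_splits)
    qed
  qed
  then show ?case by simp
qed simp

lemma dact_eq_0_absent: "occ fst (snd x) v = 0 \<Longrightarrow> dact x \<psi> v = 0"
  by (induction v arbitrary: \<psi>) (auto split: if_splits)

lemma card_nth_less_eq:
  "i \<le> length r \<Longrightarrow> card {j. j < i \<and> p (r ! j) = \<gamma>} = occ p \<gamma> (take i r)"
  unfolding length_filter_conv_card by (rule arg_cong[of _ _ card]) auto

text \<open>At the first position from the right where the inequality for \<gamma> occurs, the
  factor itself must have \<gamma> as second index, since otherwise the inequality would already
  hold one position earlier. Hence the tail \<open>s\<close> before it destroys \<gamma> at least as
  often as it creates it.\<close>

lemma irregular_decomp:
  assumes "irregular m0 m1 w"
  obtains u a \<gamma> s where "w = u @ (a, \<gamma>) # s" "\<gamma> \<in> A0 m0 \<union> A1 m1" "occ fst \<gamma> s \<le> occ snd \<gamma> s"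
proof -
  define r where "r = rev w"
  obtain i0 \<gamma> where i0: "i0 < length r" "\<gamma> \<in> A0 m0 \<union> A1 m1"
      "card {j. j \<le> i0 \<and> snd (r ! j) = \<gamma>} > card {j. j < i0 \<and> fst (r ! j) = \<gamma>}"
    using assms by (auto simp: irregular_def r_def)
  define Q where "Q i \<longleftrightarrow> i < length r \<and> occ fst \<gamma> (take i r) < occ snd \<gamma> (take (Suc i) r)" for i
  have "Q i0"
    using i0 card_nth_less_eq[of i0 r fst \<gamma>] card_nth_less_eq[of "Suc i0" r snd \<gamma>]
    by (simp add: Q_def less_Suc_eq_le)
  then obtain i where i: "Q i" "\<And>j. j < i \<Longrightarrow> \<not> Q j"
    by (metis exists_least_iff)
  have ir: "i < length r" using i(1) by (simp add: Q_def)
  have take: "take (Suc i) r = take i r @ [r ! i]"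
    using ir by (rule take_Suc_conv_app_nth)
  have "snd (r ! i) = \<gamma>"
  proof (rule ccontr)
    assume *: "snd (r ! i) \<noteq> \<gamma>"
    with i(1) have lt: "occ fst \<gamma> (take i r) < occ snd \<gamma> (take i r)" by (simp add: Q_def take)
    then obtain j where j: "i = Suc j" by (cases i) auto
    then have "occ fst \<gamma> (take j r) \<le> occ fst \<gamma> (take i r)"
      using ir by (simp add: take_Suc_conv_app_nth)
    with lt have "Q j" using ir by (simp add: Q_def j)
    with i(2) j show False by auto
  qed
  moreover from this have "occ fst \<gamma> (take i r) \<le> occ snd \<gamma> (take i r)"
    using i(1) by (simp add: Q_def take)
  moreover have "w = rev (drop (Suc i) r) @ r ! i # rev (take i r)"
    using arg_cong[OF id_take_nth_drop[OF ir], of rev] by (simp add: r_def)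
  ultimately show thesis
    using i0(2) by (intro that[of "rev (drop (Suc i) r)" "fst (r ! i)" \<gamma> "rev (take i r)"])
      (auto simp: rev_filter[symmetric])
qed

lemma irregularI:
  assumes "\<gamma> \<in> A0 m0 \<union> A1 m1" "\<gamma> \<notin> fst ` set s"
  shows "irregular m0 m1 (u @ (a, \<gamma>) # s)"
  unfolding irregular_def
proof (intro exI[of _ "length s"] conjI bexI[OF _ assms(1)])
  let ?r = "rev (u @ (a, \<gamma>) # s)"
  have "{j. j < length s \<and> fst (?r ! j) = \<gamma>} = {}"
    using assms(2) by (auto simp: nth_append image_iff) (metis nth_mem set_rev length_rev)
  moreover have "length s \<in> {j. j \<le> length s \<and> snd (?r ! j) = \<gamma>}"
    by (simp add: nth_append)
  then have "card {j. j \<le> length s \<and> snd (?r ! j) = \<gamma>} > 0"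
    by (subst card_gt_0_iff) auto
  ultimately show "card {j. j < length s \<and> fst (?r ! j) = \<gamma>} < card {j. j \<le> length s \<and> snd (?r ! j) = \<gamma>}"
    by (simp only: card.empty)
qed simp

text \<open>Starting without \<gamma>, the tail of the decomposition can leave no \<gamma> behind,
  so the annihilator of \<gamma> in front of it has nothing to hit.\<close>

lemma dact_word_irregular:
  assumes "irregular m0 m1 w" "fst ` set v \<inter> (A0 m0 \<union> A1 m1) = {}"
  shows "dact_word w \<phi> v = 0"
proof -
  obtain u a \<gamma> s where w: "w = u @ (a, \<gamma>) # s" and \<gamma>: "\<gamma> \<in> A0 m0 \<union> A1 m1"
    and le: "occ fst \<gamma> s \<le> occ snd \<gamma> s"
    using irregular_decomp[OF assms(1)] by metis
  have [simp]: "occ fst \<gamma> v = 0" using assms(2) \<gamma> by (auto simp: filter_empty_conv)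
  have "dact_word s (dact (a, \<gamma>) (dact_word u \<phi>)) v = 0"
  proof (rule dact_word_eq_0_occ[of \<gamma>])
    show "\<gamma> \<noteq> Letter i" for i using \<gamma> by (auto simp: A0_def A1_def)
    fix v' :: "(symb \<times> nat) list" assume "occ fst \<gamma> v' + occ snd \<gamma> s = occ fst \<gamma> v + occ fst \<gamma> s"
    then have "occ fst \<gamma> v' = 0" using le \<open>occ fst \<gamma> v = 0\<close> by linarith
    then show "dact (a, \<gamma>) (dact_word u \<phi>) v' = 0"
      by (intro dact_eq_0_absent) simp
  qed
  then show ?thesis by (simp add: w dact_word_append)
qed

section \<open>Leading terms and dual words\<close>

lemma dact_eq_0_length:
  "(\<And>v'. length v \<le> length v' + 1 \<Longrightarrow> \<psi> v' = 0) \<Longrightarrow> dact x \<psi> v = 0"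
proof (induction v arbitrary: \<psi>)
  case (Cons p v)
  have "dact x (\<lambda>v'. \<psi> (p # v')) v = 0"
    by (rule Cons.IH) (auto intro: Cons.prems)
  then show ?case by (simp add: Cons.prems)
qed simp

text \<open>One factor shortens a word by at most one letter, through the shift term, so a
  functional supported on short words does not see products with too few factors.\<close>

lemma dact_word_eq_0_length:
  "(\<And>v'. length v \<le> length v' + length w \<Longrightarrow> \<psi> v' = 0) \<Longrightarrow> dact_word w \<psi> v = 0"
proof (induction w arbitrary: \<psi>)
  case (Cons x w)
  have "dact_word w (dact x \<psi>) v = 0"
    by (rule Cons.IH, rule dact_eq_0_length, rule Cons.prems) simp
  then show ?case by simp
qed simp

abbreviation unit_fun :: "(symb \<times> nat) list \<Rightarrow> complex" where
  "unit_fun v \<equiv> of_bool (v = [])"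

abbreviation elt :: "nat \<times> nat \<Rightarrow> symb \<times> symb" where
  "elt p \<equiv> (Letter (fst p), Letter (snd p))"

text \<open>The only letter that \<open>e_{i,j}\<close> can turn into the constant 1: the letter
  must carry the symbol \<open>j\<close> to be hit, and the shift contributes when its second index
  is \<open>i\<close>.\<close>

abbreviation dual_elt :: "nat \<times> nat \<Rightarrow> symb \<times> nat" where
  "dual_elt p \<equiv> (Letter (snd p), fst p)"

text \<open>The bound on the support of \<psi> leaves only shift terms, that is, deletions of one
  letter dual to \<open>p\<close>. All signs are 1 because letters with a proper symbol are
  even.\<close>

lemma dact_dual:
  assumes "\<And>v'. length q \<le> length v' \<Longrightarrow> \<psi> v' = 0"
    and "\<And>r s. q = r @ p # s \<Longrightarrow> \<psi> (map dual_elt (r @ s)) = C"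
  shows "dact (elt p) \<psi> (map dual_elt q) = of_nat (count (mset q) p) * C"
  using assms
proof (induction q arbitrary: \<psi>)
  case (Cons y q)
  have "dact (elt p) (\<lambda>v'. \<psi> (dual_elt y # v')) (map dual_elt q) = of_nat (count (mset q) p) * C"
  proof (rule Cons.IH)
    fix r s assume "q = r @ p # s"
    then show "\<psi> (dual_elt y # map dual_elt (r @ s)) = C"
      using Cons.prems(2)[of "y # r" s] by simp
  qed (simp add: Cons.prems(1))
  moreover have "\<psi> (map dual_elt q) = C" if "y = p"
    using Cons.prems(2)[of "[]" q] that by simp
  moreover have "\<psi> ((a, b) # map dual_elt q) = 0" for a b
    by (rule Cons.prems(1)) simp
  ultimately show ?case
    by (auto simp: prod_eq_iff algebra_simps)
qed simp

lemma prod_fact_count_add_mset: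
  "(\<Prod>y\<in>set_mset (add_mset x A). fact (count (add_mset x A) y)) =
     (count A x + 1) * (\<Prod>y\<in>set_mset A. fact (count A y) :: nat)"
proof -
  have "(\<Prod>y\<in>set_mset (add_mset x A). fact (count (add_mset x A) y)) =
      (\<Prod>y\<in>insert x (set_mset A). (if y = x then count A x + 1 else 1) * fact (count A y) :: nat)"
    by (intro prod.cong) auto
  also have "\<dots> = (count A x + 1) * (\<Prod>y\<in>insert x (set_mset A). fact (count A y))"
    by (subst prod.distrib) simp
  also have "(\<Prod>y\<in>insert x (set_mset A). fact (count A y) :: nat) = (\<Prod>y\<in>set_mset A. fact (count A y))"
    by (rule prod.mono_neutral_right) (auto simp: not_in_iff)
  finally show ?thesis .
qed

text \<open>Each factor must delete one dual letter, so the value counts the bijections that match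
  every factor with its own dual. The last factor acts first, whence the induction from the
  right.\<close>

lemma dact_word_dual:
  "length q = length q' \<Longrightarrow> dact_word (map elt q) unit_fun (map dual_elt q') =
     (if mset q = mset q' then of_nat (\<Prod>x\<in>set_mset (mset q). fact (count (mset q) x)) else 0)"
proof (induction q arbitrary: q' rule: rev_induct)
  case (snoc p q)
  define \<psi> where "\<psi> = dact_word (map elt q) unit_fun"
  define C where "C = (if mset (q @ [p]) = mset q' then of_nat (\<Prod>x\<in>set_mset (mset q). fact (count (mset q) x)) else 0 :: complex)"
  have "dact (elt p) \<psi> (map dual_elt q') = of_nat (count (mset q') p) * C"
  proof (rule dact_dual)
    fix v' :: "(symb \<times> nat) list" assume "length q' \<le> length v'"
    then show "\<psi> v' = 0"
      unfolding \<psi>_def using snoc.prems by (intro dact_word_eq_0_length) auto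
  next
    fix r s assume "q' = r @ p # s"
    then show "\<psi> (map dual_elt (r @ s)) = C"
      unfolding \<psi>_def C_def using snoc.prems snoc.IH[of "r @ s"] by (simp add: eq_commute)
  qed
  also have "of_nat (count (mset q') p) * C = (if mset (q @ [p]) = mset q'
     then of_nat (\<Prod>x\<in>set_mset (mset (q @ [p])). fact (count (mset (q @ [p])) x)) else 0)"
  proof (cases "mset (q @ [p]) = mset q'")
    case True
    have *: "mset (q @ [p]) = add_mset p (mset q)" by simp
    have "count (add_mset p (mset q)) p = count (mset q) p + 1" by simp
    then show ?thesis
      unfolding C_def True[symmetric] unfolding * prod_fact_count_add_mset
      by (simp only: refl if_True of_nat_mult)
  qed (simp add: C_def)
  finally show ?case
    by (simp add: dact_word_append \<psi>_def)
qed simp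

text \<open>Sorting by adjacent transpositions for an arbitrary preorder \<open>P\<close>; it is
  applied both to congruence up to lower degree and to factors that commute outright.\<close>

lemma mset_eq_adjacent_swaps:
  assumes "mset u = M" "mset w = M"
    and refl: "\<And>w. P w w" and trans: "\<And>u v w. P u v \<Longrightarrow> P v w \<Longrightarrow> P u w"
    and swap: "\<And>p x y q. mset (p @ x # y # q) = M \<Longrightarrow> P (p @ x # y # q) (p @ y # x # q)"
  shows "P u w"
proof -
  have front: "P (p @ x # a @ b) (p @ a @ x # b)" if "mset (p @ x # a @ b) = M" for p x a b
    using that
  proof (induction a arbitrary: p)
    case (Cons y a)
    have "P (p @ x # y # a @ b) (p @ y # x # a @ b)"
      by (rule swap) (use Cons.prems in \<open>simp add: add_mset_commute\<close>)
    moreover have "P ((p @ [y]) @ x # a @ b) ((p @ [y]) @ a @ x # b)"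
      by (rule Cons.IH) (use Cons.prems in \<open>simp add: add_mset_commute\<close>)
    ultimately show ?case using trans by simp
  qed (simp add: refl)
  have "P (p @ u) (p @ w)" if "mset (p @ u) = M" "mset u = mset w" for p
    using that
  proof (induction u arbitrary: p w)
    case (Cons x u)
    then obtain a b where w: "w = a @ x # b"
      by (metis list.set_intros(1) mset_eq_setD split_list)
    have "P ((p @ [x]) @ u) ((p @ [x]) @ a @ b)"
      by (rule Cons.IH) (use Cons.prems w in auto)
    moreover have "P (p @ x # a @ b) (p @ a @ x # b)"
      by (rule front) (use Cons.prems w in auto)
    ultimately show ?case using trans w by simp
  qed (simp add: refl)
  from this[of "[]"] show ?thesis using assms(1,2) by simp
qed

section \<open>The enveloping algebra as a quotient\<close>

type_synonym fpoly = "(symb \<times> symb) list \<Rightarrow>\<^sub>0 complex"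

definition polys_on :: "(symb \<times> symb) set \<Rightarrow> fpoly set" where
  "polys_on B = {f. Poly_Mapping.keys f \<subseteq> lists B}"

lemma free_algebra_carrier: "carrier (free_algebra B) = polys_on B"
  by (simp add: free_algebra_def polys_on_def)

lemma polys_on_simps [simp, intro]:
  "0 \<in> polys_on B" "1 \<in> polys_on B" "const c \<in> polys_on B"
  "f \<in> polys_on B \<Longrightarrow> g \<in> polys_on B \<Longrightarrow> f + g \<in> polys_on B"
  "f \<in> polys_on B \<Longrightarrow> g \<in> polys_on B \<Longrightarrow> f - g \<in> polys_on B"
  "f \<in> polys_on B \<Longrightarrow> - f \<in> polys_on B"
  "f \<in> polys_on B \<Longrightarrow> g \<in> polys_on B \<Longrightarrow> f * g \<in> polys_on B"
  "set w \<subseteq> B \<Longrightarrow> word w \<in> polys_on B"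
  unfolding polys_on_def
  using Poly_Mapping.keys_add[of f g] keys_diff[of f g] keys_mult[of f g]
  by (fastforce simp: plus_list_def zero_list_def split: if_splits)+

lemma polys_on_sum: "(\<And>i. i \<in> A \<Longrightarrow> f i \<in> polys_on B) \<Longrightarrow> (\<Sum>i\<in>A. f i) \<in> polys_on B"
  by (induction A rule: infinite_finite_induct) auto

lemma polys_on_mono: "f \<in> polys_on A \<Longrightarrow> A \<subseteq> B \<Longrightarrow> f \<in> polys_on B"
  unfolding polys_on_def by auto

lemma free_algebra_simps:
  "f \<otimes>\<^bsub>free_algebra B\<^esub> g = f * g" "f \<oplus>\<^bsub>free_algebra B\<^esub> g = f + g"
  "\<one>\<^bsub>free_algebra B\<^esub> = 1" "\<zero>\<^bsub>free_algebra B\<^esub> = 0"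
  by (simp_all add: free_algebra_def)

locale enveloping =
  fixes m0 m1 n :: nat
begin

abbreviation "B \<equiv> gl_basis m0 m1 n"
abbreviation "L \<equiv> Lset n \<times> Lset n"
abbreviation "I \<equiv> gl_ideal m0 m1 n"
abbreviation "U \<equiv> Ugl m0 m1 n"
abbreviation "cls \<equiv> Ucls m0 m1 n"

lemma L_subset_B: "L \<subseteq> B"
  by (auto simp: gl_basis_def)

lemma ideal_I: "ideal I (free_algebra B)"
  unfolding gl_ideal_def
  by (rule ring.genideal_ideal[OF ring_free_algebra gl_relations_carrier])

lemma I_subset: "I \<subseteq> polys_on B"
  using ideal_I by (simp add: ideal_def additive_subgroup.a_subset free_algebra_carrier[symmetric])

lemma I_zero: "0 \<in> I"
  using additive_subgroup.zero_closed[OF ideal.axioms(1)[OF ideal_I]] by (simp add: free_algebra_simps)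

lemma I_add: "f \<in> I \<Longrightarrow> g \<in> I \<Longrightarrow> f + g \<in> I"
  using additive_subgroup.a_closed[OF ideal.axioms(1)[OF ideal_I]] by (simp add: free_algebra_simps)

lemma I_mult_left: "f \<in> I \<Longrightarrow> g \<in> polys_on B \<Longrightarrow> g * f \<in> I"
  using ideal.I_l_closed[OF ideal_I] by (simp add: free_algebra_simps free_algebra_carrier)

lemma I_mult_right: "f \<in> I \<Longrightarrow> g \<in> polys_on B \<Longrightarrow> f * g \<in> I"
  using ideal.I_r_closed[OF ideal_I] by (simp add: free_algebra_simps free_algebra_carrier)

lemma I_relation:
  "x \<in> B \<Longrightarrow> y \<in> B \<Longrightarrow> word [x] * word [y] - const (gl_sign x y) * (word [y] * word [x]) - gl_bracket x y \<in> I"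
  using ring.genideal_self[OF ring_free_algebra gl_relations_carrier]
  unfolding gl_ideal_def gl_relations_def by blast

lemma hom_cls: "ring_hom_ring (free_algebra B) U cls"
  using ideal.rcos_ring_hom_ring[OF ideal_I] by (simp add: Ugl_def Ucls_def[abs_def])

lemma cls_closed: "f \<in> polys_on B \<Longrightarrow> cls f \<in> carrier U"
  using ring_hom_closed[OF ring_hom_ring.homh[OF hom_cls]] by (simp add: free_algebra_carrier)

lemma cls_add: "f \<in> polys_on B \<Longrightarrow> g \<in> polys_on B \<Longrightarrow> cls f \<oplus>\<^bsub>U\<^esub> cls g = cls (f + g)"
  using ring_hom_add[OF ring_hom_ring.homh[OF hom_cls]] by (simp add: free_algebra_carrier free_algebra_simps)

lemma cls_mult: "f \<in> polys_on B \<Longrightarrow> g \<in> polys_on B \<Longrightarrow> cls f \<otimes>\<^bsub>U\<^esub> cls g = cls (f * g)"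
  using ring_hom_mult[OF ring_hom_ring.homh[OF hom_cls]] by (simp add: free_algebra_carrier free_algebra_simps)

lemma cls_one: "\<one>\<^bsub>U\<^esub> = cls 1"
  using ring_hom_one[OF ring_hom_ring.homh[OF hom_cls]] by (simp add: free_algebra_simps)

lemma cls_zero: "\<zero>\<^bsub>U\<^esub> = cls 0"
  using ring_hom_zero[OF ring_hom_ring.homh[OF hom_cls] ring_free_algebra ring_Ugl] by (simp add: free_algebra_simps)

lemma cls_uminus:
  assumes "f \<in> polys_on B"
  shows "\<ominus>\<^bsub>U\<^esub> cls f = cls (- f)"
proof -
  interpret U: ring U by (rule ring_Ugl)
  have "cls (- f) \<oplus>\<^bsub>U\<^esub> cls f = \<zero>\<^bsub>U\<^esub>"
    using assms by (simp add: cls_add cls_zero)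
  then show ?thesis
    using U.minus_equality[of "cls (- f)" "cls f"] assms by (simp add: cls_closed)
qed

lemma cls_diff: "f \<in> polys_on B \<Longrightarrow> g \<in> polys_on B \<Longrightarrow> cls f \<ominus>\<^bsub>U\<^esub> cls g = cls (f - g)"
  by (simp add: a_minus_def cls_uminus cls_add)

lemma cls_surj: "u \<in> carrier U \<Longrightarrow> \<exists>f\<in>polys_on B. u = cls f"
  by (auto simp: Ugl_def FactRing_def A_RCOSETS_def' Ucls_def free_algebra_carrier)

lemma cls_eq_zero_iff:
  assumes "f \<in> polys_on B"
  shows "cls f = \<zero>\<^bsub>U\<^esub> \<longleftrightarrow> f \<in> I"
proof -
  interpret ideal I "free_algebra B" by (rule ideal_I)
  have "\<zero>\<^bsub>U\<^esub> = I" by (simp add: Ugl_def FactRing_def)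
  moreover have "cls f = I \<longleftrightarrow> f \<in> I"
    unfolding Ucls_def using rcos_const_imp_mem a_rcos_const assms
    by (auto simp: free_algebra_carrier)
  ultimately show ?thesis by simp
qed

lemma cls_eq_iff:
  assumes "f \<in> polys_on B" "g \<in> polys_on B"
  shows "cls f = cls g \<longleftrightarrow> f - g \<in> I"
proof -
  interpret U: ring U by (rule ring_Ugl)
  have "cls f = cls g \<longleftrightarrow> cls f \<ominus>\<^bsub>U\<^esub> cls g = \<zero>\<^bsub>U\<^esub>"
    using assms by (simp add: cls_closed U.r_right_minus_eq)
  then show ?thesis using assms by (simp add: cls_diff cls_eq_zero_iff)
qed

lemma cls_sum:
  assumes "finite A" "\<And>i. i \<in> A \<Longrightarrow> f i \<in> polys_on B"
  shows "(\<Oplus>\<^bsub>U\<^esub>i\<in>A. cls (f i)) = cls (\<Sum>i\<in>A. f i)"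
proof -
  interpret U: ring U by (rule ring_Ugl)
  show ?thesis using assms
    by (induction A rule: finite_induct)
      (auto simp: cls_zero[symmetric] U.finsum_insert cls_closed Pi_def cls_add polys_on_sum)
qed

lemma Uscale_cls: "f \<in> polys_on B \<Longrightarrow> Uscale m0 m1 n c (cls f) = cls (const c * f)"
  by (simp add: Uscale_def cls_mult)

text \<open>The polynomials that act as zero form a two-sided ideal containing the defining
  relations, so the action descends to the enveloping algebra.\<close>

lemma dact_poly_ideal:
  assumes "f \<in> I"
  shows "dact_poly f \<phi> v = 0"
proof -
  define N where "N = {f \<in> polys_on B. \<forall>\<phi> v. dact_poly f \<phi> v = 0}"
  have "ideal N (free_algebra B)"
  proof (rule idealI[OF ring_free_algebra])
    interpret ring "free_algebra B" by (rule ring_free_algebra)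
    show "subgroup N (add_monoid (free_algebra B))"
    proof (rule add.subgroupI)
      show "\<ominus>\<^bsub>free_algebra B\<^esub> f \<in> N" if "f \<in> N" for f
      proof -
        have "\<ominus>\<^bsub>free_algebra B\<^esub> f = - f"
          by (rule minus_equality) (use that in \<open>auto simp: free_algebra_simps free_algebra_carrier N_def\<close>)
        moreover have "- f \<in> N" using that by (auto simp: N_def dact_poly_uminus)
        ultimately show ?thesis by (simp only:)
      qed
    qed (auto simp: N_def free_algebra_carrier free_algebra_simps dact_poly_plus dact_poly_0 intro!: exI[of _ 0])
  next
    fix f g assume "f \<in> N" "g \<in> carrier (free_algebra B)"
    then have f: "dact_poly f \<phi> = (\<lambda>v. 0)" "f \<in> polys_on B" "g \<in> polys_on B" for \<phi>
      by (auto simp: N_def free_algebra_carrier fun_eq_iff)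
    show "g \<otimes>\<^bsub>free_algebra B\<^esub> f \<in> N" "f \<otimes>\<^bsub>free_algebra B\<^esub> g \<in> N"
      using f by (simp_all add: N_def free_algebra_simps dact_poly_mult dact_poly_zero_arg)
  qed
  moreover have "gl_relations m0 m1 n \<subseteq> N"
  proof
    fix f assume f: "f \<in> gl_relations m0 m1 n"
    then obtain x y where "f = word [x] * word [y] - const (gl_sign x y) * (word [y] * word [x]) - gl_bracket x y"
      unfolding gl_relations_def by blast
    moreover have "f \<in> polys_on B" using f gl_relations_carrier by (auto simp: free_algebra_carrier)
    ultimately show "f \<in> N" using dact_poly_relation by (simp only: N_def mem_Collect_eq simp_thms)
  qed
  ultimately have "I \<subseteq> N"
    unfolding gl_ideal_def by (rule ring.genideal_minimal[OF ring_free_algebra])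
  with assms show ?thesis by (auto simp: N_def)
qed

end

section \<open>Faithfulness on the proper part\<close>

lemma const_left_commute: "f * (const c * g) = const c * (f * (g :: 'x list \<Rightarrow>\<^sub>0 complex))"
  by (metis const_commute mult.assoc)

lemma word_Nil [simp]: "word [] = 1"
  by (metis single_one zero_list_def)

context enveloping
begin

lemma word_swap:
  assumes "x \<in> B" "y \<in> B" "set p \<subseteq> B" "set q \<subseteq> B"
  shows "word (p @ x # y # q) - const (gl_sign x y) * word (p @ y # x # q) - word p * gl_bracket x y * word q \<in> I"
proof -
  have "word p * (word [x] * word [y] - const (gl_sign x y) * (word [y] * word [x]) - gl_bracket x y) * word q \<in> I"
    using assms by (intro I_mult_left I_mult_right I_relation polys_on_simps)
  also have "word p * (word [x] * word [y] - const (gl_sign x y) * (word [y] * word [x]) - gl_bracket x y) * word q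
     = word (p @ x # y # q) - const (gl_sign x y) * word (p @ y # x # q) - word p * gl_bracket x y * word q"
    by (simp only: left_diff_distrib right_diff_distrib word_mult const_left_commute mult.assoc) (simp add: word_mult)
  finally show ?thesis .
qed

section \<open>The degree filtration on the proper part\<close>

definition deg_less :: "nat \<Rightarrow> fpoly set" where
  "deg_less d = {r \<in> polys_on L. \<forall>w\<in>Poly_Mapping.keys r. length w < d}"

lemma deg_less_simps [simp, intro]:
  "0 \<in> deg_less d"
  "f \<in> deg_less d \<Longrightarrow> g \<in> deg_less d \<Longrightarrow> f + g \<in> deg_less d"
  "f \<in> deg_less d \<Longrightarrow> g \<in> deg_less d \<Longrightarrow> f - g \<in> deg_less d"
  "f \<in> deg_less d \<Longrightarrow> const c * f \<in> deg_less d"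
  "set w \<subseteq> L \<Longrightarrow> length w < d \<Longrightarrow> word w \<in> deg_less d"
  unfolding deg_less_def
  using Poly_Mapping.keys_add[of f g] keys_diff[of f g] keys_mult[of "const c" f]
  by (fastforce simp: plus_list_def split: if_splits)+

definition deg_less_mod :: "nat \<Rightarrow> fpoly set" where
  "deg_less_mod d = {f. \<exists>r \<in> deg_less d. f - r \<in> I}"

lemma deg_less_mod_add:
  assumes "f \<in> deg_less_mod d" "g \<in> deg_less_mod d"
  shows "f + g \<in> deg_less_mod d"
proof -
  obtain r s where "r \<in> deg_less d" "s \<in> deg_less d" "f - r \<in> I" "g - s \<in> I"
    using assms by (auto simp: deg_less_mod_def)
  then show ?thesis
    using I_add[of "f - r" "g - s"] unfolding deg_less_mod_def
    by (intro CollectI bexI[of _ "r + s"]) (auto simp: algebra_simps)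
qed

lemma deg_less_mod_scale:
  assumes "f \<in> deg_less_mod d"
  shows "const c * f \<in> deg_less_mod d"
proof -
  obtain r where "r \<in> deg_less d" "f - r \<in> I"
    using assms by (auto simp: deg_less_mod_def)
  then show ?thesis
    using I_mult_left[of "f - r" "const c"] unfolding deg_less_mod_def
    by (intro CollectI bexI[of _ "const c * r"]) (auto simp: algebra_simps)
qed

lemma deg_less_mod_base: "f \<in> deg_less d \<Longrightarrow> f \<in> deg_less_mod d"
  unfolding deg_less_mod_def by (auto intro!: bexI[of _ f] I_zero)

lemma deg_less_mod_sum: "(\<And>i. i \<in> A \<Longrightarrow> f i \<in> deg_less_mod d) \<Longrightarrow> (\<Sum>i\<in>A. f i) \<in> deg_less_mod d"
  by (induction A rule: infinite_finite_induct) (auto intro: deg_less_mod_add deg_less_mod_base)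

text \<open>Proper basis elements are even, and their bracket turns two factors into one; the
  associated graded algebra is thus commutative.\<close>

lemma word_permute:
  assumes "mset u = mset w" "set u \<subseteq> L"
  shows "word u - word w \<in> deg_less_mod (length u)"
proof (rule mset_eq_adjacent_swaps[where M = "mset u" and P = "\<lambda>u' w. word u' - word w \<in> deg_less_mod (length u)"])
  show "word w - word w \<in> deg_less_mod (length u)" for w by (auto intro: deg_less_mod_base)
  show "word u1 - word u3 \<in> deg_less_mod (length u)"
    if "word u1 - word u2 \<in> deg_less_mod (length u)" "word u2 - word u3 \<in> deg_less_mod (length u)" for u1 u2 u3
    using deg_less_mod_add[OF that] by simp
next
  fix p x y q assume m: "mset (p @ x # y # q) = mset u"
  then have "set (p @ x # y # q) \<subseteq> L" using assms(2) mset_eq_setD by blast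
  then have L: "x \<in> L" "y \<in> L" "set p \<subseteq> L" "set q \<subseteq> L" by auto
  have len: "length u = length p + length q + 2" using mset_eq_length[OF m] by simp
  have "gl_sign x y = 1" using L by (auto simp: gl_sign_def Lset_def)
  then have *: "word (p @ x # y # q) - word (p @ y # x # q) - word p * gl_bracket x y * word q \<in> I"
    using word_swap[of x y p q] L L_subset_B by auto
  have "word p * gl_bracket x y * word q =
     (if snd x = fst y then word (p @ (fst x, snd y) # q) else 0)
     - (if fst x = snd y then word (p @ (fst y, snd x) # q) else 0)"
    using \<open>gl_sign x y = 1\<close> by (simp add: gl_bracket_def word_mult left_diff_distrib right_diff_distrib)
  also have "\<dots> \<in> deg_less (length u)"
    using L by (intro deg_less_simps) (auto simp: len intro!: deg_less_simps)
  finally show "word (p @ x # y # q) - word (p @ y # x # q) \<in> deg_less_mod (length u)"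
    using * unfolding deg_less_mod_def by blast
qed (use assms in auto)

definition index :: "symb \<Rightarrow> nat" where
  "index a = (case a of Letter i \<Rightarrow> i | _ \<Rightarrow> 0)"

definition unelt :: "symb \<times> symb \<Rightarrow> nat \<times> nat" where
  "unelt x = (index (fst x), index (snd x))"

lemma elt_unelt: "set w \<subseteq> L \<Longrightarrow> map elt (map unelt w) = w"
  by (auto simp: Lset_def unelt_def index_def intro!: map_idI)

lemma dact_word_unit_fun:
  assumes "set w \<subseteq> L" "set w0 \<subseteq> L" "length w = length w0"
  shows "dact_word w unit_fun (map dual_elt (map unelt w0)) =
    (if mset w = mset w0 then of_nat (\<Prod>x\<in>set_mset (mset (map unelt w0)). fact (count (mset (map unelt w0)) x)) else 0)"
proof -
  have "mset w = mset w0" if "mset (map unelt w) = mset (map unelt w0)"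
    using arg_cong[OF that, of "image_mset elt"] elt_unelt[OF assms(1)] elt_unelt[OF assms(2)]
    by (metis mset_map)
  then have "mset (map unelt w) = mset (map unelt w0) \<longleftrightarrow> mset w = mset w0"
    by (metis mset_map)
  then show ?thesis
    using dact_word_dual[of "map unelt w" "map unelt w0"] assms elt_unelt[OF assms(1)] by auto
qed

text \<open>Functionals dual to words of top degree see only the multiset of a word, so the
  coefficients of each multiset sum to zero. Rearranging the top words to common representatives
  then cancels the top part, and \<open>f\<close> drops to lower degree modulo
  \<open>I\<close>.\<close>

lemma deg_less_kernel:
  assumes "f \<in> deg_less d"
    and "\<And>v. fst ` set v \<subseteq> range Letter \<Longrightarrow> dact_poly f unit_fun v = 0"
  shows "f \<in> I"
  using assms
proof (induction d arbitrary: f)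
  case 0
  then have "f = 0" by (auto simp: deg_less_def simp flip: keys_eq_empty)
  then show ?case by (simp add: I_zero)
next
  case (Suc d)
  define T where "T = {w \<in> Poly_Mapping.keys f. length w = d}"
  define c where "c w = Poly_Mapping.lookup f w" for w
  \<comment> \<open>Any choice that depends on the multiset alone serves as a normal form.\<close>
  define srt :: "(symb \<times> symb) list \<Rightarrow> (symb \<times> symb) list" where "srt w = (SOME u. mset u = mset w)" for w
  have srt: "mset (srt w) = mset w" for w
    unfolding srt_def by (rule someI[of _ w]) simp
  have srt_eq: "srt u = srt w \<longleftrightarrow> mset u = mset w" for u w
    using srt by (metis srt_def)
  have keysL: "set w \<subseteq> L" "length w \<le> d" if "w \<in> Poly_Mapping.keys f" for w
    using Suc.prems(1) that by (fastforce simp: deg_less_def polys_on_def)+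
  have finT: "finite T" by (simp add: T_def)
  have sum0: "(\<Sum>w | w \<in> T \<and> mset w = mset w0. c w) = 0" if "w0 \<in> T" for w0
  proof -
    define v where "v = map dual_elt (map unelt w0)"
    define K where "K = (of_nat (\<Prod>x\<in>set_mset (mset (map unelt w0)). fact (count (mset (map unelt w0)) x)) :: complex)"
    have w0: "set w0 \<subseteq> L" "length w0 = d" using that keysL by (auto simp: T_def)
    \<comment> \<open>Pairing with the dual of \<open>w0\<close>: shorter words contribute nothing,
      and words of length \<open>d\<close> contribute the nonzero constant \<open>K\<close> exactly
      when they are permutations of \<open>w0\<close>.\<close>
    have "0 = dact_poly f unit_fun v"
      by (rule Suc.prems(2)[symmetric]) (auto simp: v_def)
    also have "\<dots> = (\<Sum>w\<in>T. c w * dact_word w unit_fun v)"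
      unfolding dact_poly_def c_def
    proof (rule sum.mono_neutral_right)
      show "\<forall>w\<in>Poly_Mapping.keys f - T. Poly_Mapping.lookup f w * dact_word w unit_fun v = 0"
      proof
        fix w assume "w \<in> Poly_Mapping.keys f - T"
        then have "length w < d" using keysL[of w] by (auto simp: T_def)
        then have "dact_word w unit_fun v = 0"
          by (intro dact_word_eq_0_length) (auto simp: v_def w0)
        then show "Poly_Mapping.lookup f w * dact_word w unit_fun v = 0" by simp
      qed
    qed (auto simp: T_def)
    also have "\<dots> = (\<Sum>w\<in>T. (if mset w = mset w0 then c w else 0) * K)"
    proof (rule sum.cong)
      fix w assume "w \<in> T"
      then have "set w \<subseteq> L" "length w = length w0" using keysL w0 by (auto simp: T_def)
      from dact_word_unit_fun[OF this(1) w0(1) this(2)]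
      show "c w * dact_word w unit_fun v = (if mset w = mset w0 then c w else 0) * K"
        unfolding v_def K_def by auto
    qed simp
    also have "\<dots> = (\<Sum>w | w \<in> T \<and> mset w = mset w0. c w) * K"
      by (simp add: sum_distrib_right[symmetric] sum.inter_filter[OF finT])
    finally show ?thesis by (simp add: K_def)
  qed
  have zero: "(\<Sum>w\<in>T. const (c w) * word (srt w)) = 0"
  proof (rule poly_mapping_eqI)
    fix u
    have "Poly_Mapping.lookup (\<Sum>w\<in>T. const (c w) * word (srt w)) u = (\<Sum>w\<in>T. if srt w = u then c w else 0)"
      unfolding lookup_sum by (intro sum.cong) (auto simp: const_mult_single lookup_single)
    also have "\<dots> = (\<Sum>w | w \<in> T \<and> srt w = u. c w)"
      by (simp add: sum.inter_filter[OF finT])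
    also have "\<dots> = 0"
    proof (cases "\<exists>w0\<in>T. srt w0 = u")
      case True
      then obtain w0 where "w0 \<in> T" "srt w0 = u" by blast
      then show ?thesis using sum0[of w0] srt_eq[of _ w0] by simp
    next
      case False
      then have "{w. w \<in> T \<and> srt w = u} = {}" by auto
      then show ?thesis by (simp only: sum.empty)
    qed
    finally show "Poly_Mapping.lookup (\<Sum>w\<in>T. const (c w) * word (srt w)) u = Poly_Mapping.lookup 0 u" by simp
  qed
  have "f = (\<Sum>w\<in>T. const (c w) * word w) + (\<Sum>w\<in>Poly_Mapping.keys f - T. const (c w) * word w)"
    unfolding c_def
    by (subst (1) free_algebra_expand) (subst add.commute, rule sum.subset_diff, auto simp: T_def)
  \<comment> \<open>Subtracting the vanishing sum \<open>zero\<close> turns each top word into a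
    difference that has lower degree modulo \<open>I\<close>.\<close>
  also have "(\<Sum>w\<in>T. const (c w) * word w) = (\<Sum>w\<in>T. const (c w) * (word w - word (srt w)))"
    using zero by (simp add: right_diff_distrib sum_subtractf)
  also have "\<dots> + (\<Sum>w\<in>Poly_Mapping.keys f - T. const (c w) * word w) \<in> deg_less_mod d"
  proof (intro deg_less_mod_add deg_less_mod_sum deg_less_mod_scale)
    fix w assume "w \<in> T"
    then show "word w - word (srt w) \<in> deg_less_mod d"
      using word_permute[of w "srt w"] srt keysL by (auto simp: T_def)
  next
    fix w assume "w \<in> Poly_Mapping.keys f - T"
    then have "length w < d" "set w \<subseteq> L" using keysL[of w] by (auto simp: T_def)
    then show "word w \<in> deg_less_mod d" by (intro deg_less_mod_base deg_less_simps)
  qed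
  finally obtain r where r: "r \<in> deg_less d" "f - r \<in> I" by (auto simp: deg_less_mod_def)
  have "r \<in> I"
  proof (rule Suc.IH[OF r(1)])
    fix v :: "(symb \<times> nat) list" assume "fst ` set v \<subseteq> range Letter"
    then show "dact_poly r unit_fun v = 0"
      using dact_poly_ideal[OF r(2), of unit_fun v] Suc.prems(2)[of v] by (simp add: dact_poly_minus)
  qed
  then show ?case using I_add[OF r(2) \<open>r \<in> I\<close>] by simp
qed

lemma proper_kernel:
  assumes "f \<in> polys_on L"
    and "\<And>v. fst ` set v \<subseteq> range Letter \<Longrightarrow> dact_poly f unit_fun v = 0"
  shows "f \<in> I"
proof (rule deg_less_kernel[OF _ assms(2)])
  show "f \<in> deg_less (Suc (Max (length ` Poly_Mapping.keys f)))"
    using assms(1) by (auto simp: deg_less_def less_Suc_eq_le)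
qed auto

end

section \<open>The left ideal of irregular products\<close>

context enveloping
begin

abbreviation nonvirtual :: "(symb \<times> nat) list \<Rightarrow> bool" where
  "nonvirtual v \<equiv> fst ` set v \<inter> (A0 m0 \<union> A1 m1) = {}"

text \<open>An upper bound for \<open>Irr\<close> that can be tested on the module. All functionals
  \<phi> are allowed so that a left factor can be absorbed into \<phi>, which makes this a left
  ideal.\<close>

definition vacuum_annihilator :: "env set" where
  "vacuum_annihilator = {cls f | f. f \<in> polys_on B \<and> (\<forall>\<phi> v. nonvirtual v \<longrightarrow> dact_poly f \<phi> v = 0)}"

lemma vacuum_annihilatorI: "f \<in> polys_on B \<Longrightarrow> (\<And>\<phi> v. nonvirtual v \<Longrightarrow> dact_poly f \<phi> v = 0) \<Longrightarrow> cls f \<in> vacuum_annihilator"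
  by (auto simp: vacuum_annihilator_def)

lemma vacuum_annihilatorE:
  assumes "x \<in> vacuum_annihilator"
  obtains f where "f \<in> polys_on B" "x = cls f" "\<And>\<phi> v. nonvirtual v \<Longrightarrow> dact_poly f \<phi> v = 0"
  using assms by (auto simp: vacuum_annihilator_def)

lemma left_ideal_vacuum_annihilator: "left_ideal vacuum_annihilator U"
  unfolding left_ideal_def
proof (intro conjI ballI additive_subgroup.intro)
  interpret U: ring U by (rule ring_Ugl)
  show "subgroup vacuum_annihilator (add_monoid U)"
  proof (rule U.add.subgroupI)
    show "vacuum_annihilator \<subseteq> carrier U" by (auto simp: vacuum_annihilator_def cls_closed)
    show "vacuum_annihilator \<noteq> {}" by (use vacuum_annihilatorI[of 0] in \<open>auto simp: dact_poly_0\<close>)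
    show "\<ominus>\<^bsub>U\<^esub> x \<in> vacuum_annihilator" if x: "x \<in> vacuum_annihilator" for x
    proof -
      obtain f where "f \<in> polys_on B" "x = cls f" "\<And>\<phi> v. nonvirtual v \<Longrightarrow> dact_poly f \<phi> v = 0"
        using vacuum_annihilatorE[OF x] by metis
      then show ?thesis using vacuum_annihilatorI[of "- f"] by (simp add: cls_uminus dact_poly_uminus)
    qed
    show "x \<oplus>\<^bsub>U\<^esub> y \<in> vacuum_annihilator" if x: "x \<in> vacuum_annihilator" and y: "y \<in> vacuum_annihilator" for x y
    proof -
      obtain f g where "f \<in> polys_on B" "x = cls f" "\<And>\<phi> v. nonvirtual v \<Longrightarrow> dact_poly f \<phi> v = 0"
        "g \<in> polys_on B" "y = cls g" "\<And>\<phi> v. nonvirtual v \<Longrightarrow> dact_poly g \<phi> v = 0"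
        using vacuum_annihilatorE[OF x] vacuum_annihilatorE[OF y] by metis
      then show ?thesis using vacuum_annihilatorI[of "f + g"] by (simp add: cls_add dact_poly_plus)
    qed
  qed
next
  fix r x assume "r \<in> carrier U" "x \<in> vacuum_annihilator"
  then obtain g f where "g \<in> polys_on B" "r = cls g" "f \<in> polys_on B" "x = cls f"
    "\<And>\<phi> v. nonvirtual v \<Longrightarrow> dact_poly f \<phi> v = 0"
    using cls_surj[of r] vacuum_annihilatorE[of x] by metis
  then show "r \<otimes>\<^bsub>U\<^esub> x \<in> vacuum_annihilator"
    using vacuum_annihilatorI[of "g * f"] by (simp add: cls_mult dact_poly_mult)
qed

lemma Irr_subset_vacuum_annihilator: "Irr m0 m1 n \<subseteq> vacuum_annihilator"
proof -
  have "{Uprod m0 m1 n w | w. w \<in> lists B \<and> irregular m0 m1 w} \<subseteq> vacuum_annihilator"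
    by (auto simp: Uprod_def dact_poly_single dact_word_irregular intro!: vacuum_annihilatorI polys_on_simps)
  then show ?thesis using left_ideal_vacuum_annihilator unfolding Irr_def by blast
qed

lemma left_ideal_Irr: "left_ideal (Irr m0 m1 n) U"
  unfolding left_ideal_def
proof (intro conjI ballI additive_subgroup.intro)
  interpret U: ring U by (rule ring_Ugl)
  have ideals: "subgroup J (add_monoid U)" if "left_ideal J U" for J
    using that by (simp add: left_ideal_def additive_subgroup_def)
  show "subgroup (Irr m0 m1 n) (add_monoid U)"
  proof (rule U.add.subgroupI)
    \<comment> \<open>An intersection is bounded by each of its members;
      \<open>vacuum_annihilator\<close> is one and lies in the carrier.\<close>
    show "Irr m0 m1 n \<subseteq> carrier U"
      using Irr_subset_vacuum_annihilator by (auto simp: vacuum_annihilator_def cls_closed)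
    have "\<zero>\<^bsub>U\<^esub> \<in> Irr m0 m1 n"
      using subgroup.one_closed[OF ideals] by (auto simp: Irr_def)
    then show "Irr m0 m1 n \<noteq> {}" by blast
    show "\<ominus>\<^bsub>U\<^esub> x \<in> Irr m0 m1 n" if "x \<in> Irr m0 m1 n" for x
      using that subgroup.m_inv_closed[OF ideals, of _ x] by (simp add: Irr_def a_inv_def)
    show "x \<oplus>\<^bsub>U\<^esub> y \<in> Irr m0 m1 n" if "x \<in> Irr m0 m1 n" "y \<in> Irr m0 m1 n" for x y
      using that subgroup.m_closed[OF ideals, of _ x y] by (simp add: Irr_def)
  qed
next
  fix r x assume "r \<in> carrier U" "x \<in> Irr m0 m1 n"
  then show "r \<otimes>\<^bsub>U\<^esub> x \<in> Irr m0 m1 n" by (auto simp: Irr_def left_ideal_def)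
qed

section \<open>Congruences modulo \<open>Irr\<close> and the projection\<close>

text \<open>Pulling \<open>Irr\<close> back to the free algebra turns computations into congruences
  of polynomials. Only left multiplication is available for \<open>J\<close>; rewriting in front of
  a right factor has to go through the two-sided \<open>I\<close>.\<close>

definition J :: "fpoly set" where
  "J = {f \<in> polys_on B. cls f \<in> Irr m0 m1 n}"

lemma subgroup_Irr: "subgroup (Irr m0 m1 n) (add_monoid U)"
  using left_ideal_Irr by (simp add: left_ideal_def additive_subgroup_def)

lemma J_polys_on: "f \<in> J \<Longrightarrow> f \<in> polys_on B"
  by (simp add: J_def)

lemma J_add: "f \<in> J \<Longrightarrow> g \<in> J \<Longrightarrow> f + g \<in> J"
  using subgroup.m_closed[OF subgroup_Irr, of "cls f" "cls g"] by (auto simp: J_def cls_add)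

lemma J_mult: "f \<in> J \<Longrightarrow> g \<in> polys_on B \<Longrightarrow> g * f \<in> J"
  using left_ideal_Irr by (auto simp: J_def left_ideal_def simp flip: cls_mult intro: cls_closed)

lemma J_uminus: "f \<in> J \<Longrightarrow> - f \<in> J"
  using J_mult[of f "- 1"] by auto

lemma J_diff: "f \<in> J \<Longrightarrow> g \<in> J \<Longrightarrow> f - g \<in> J"
  using J_add[of f "- g"] J_uminus by auto

lemma I_subset_J: "f \<in> I \<Longrightarrow> f \<in> J"
  using subgroup.one_closed[OF subgroup_Irr] I_subset cls_eq_zero_iff[of f] by (auto simp: J_def)

lemma J_zero: "0 \<in> J"
  by (rule I_subset_J[OF I_zero])

lemma J_irregular:
  assumes "set (u @ (a, \<gamma>) # s) \<subseteq> B" "\<gamma> \<in> A0 m0 \<union> A1 m1" "\<gamma> \<notin> fst ` set s"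
  shows "word (u @ (a, \<gamma>) # s) \<in> J"
proof -
  have "u @ (a, \<gamma>) # s \<in> lists B" using assms(1) by auto
  then have "Uprod m0 m1 n (u @ (a, \<gamma>) # s) \<in> Irr m0 m1 n"
    unfolding Irr_def using irregularI[OF assms(2,3), of u a] by blast
  then show ?thesis using polys_on_simps(8)[OF assms(1)] by (simp add: J_def Uprod_def)
qed

text \<open>This is the trivial intersection of \<open>U(gl(n))\<close> with \<open>Irr\<close>:
  elements of \<open>Irr\<close> kill all words in proper letters, and by
  \<open>proper_kernel\<close> a proper polynomial that does so is zero in the enveloping
  algebra.\<close>

lemma proper_in_J:
  assumes "f \<in> polys_on L" "f \<in> J"
  shows "f \<in> I"
proof (rule proper_kernel[OF assms(1)])
  fix v :: "(symb \<times> nat) list" assume v: "fst ` set v \<subseteq> range Letter"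
  have "cls f \<in> vacuum_annihilator" using assms(2) Irr_subset_vacuum_annihilator by (auto simp: J_def)
  then obtain g where g: "g \<in> polys_on B" "cls f = cls g" "\<And>\<phi> v. nonvirtual v \<Longrightarrow> dact_poly g \<phi> v = 0"
    by (auto simp: vacuum_annihilator_def)
  have "nonvirtual v" using v by (auto simp: A0_def A1_def)
  then show "dact_poly f unit_fun v = 0"
    using dact_poly_ideal[of "f - g" unit_fun v] cls_eq_iff[of f g] g J_polys_on[OF assms(2)]
    by (simp add: dact_poly_minus)
qed

lemma Ugl_proper_iff: "u \<in> Ugl_proper m0 m1 n \<longleftrightarrow> (\<exists>f\<in>polys_on L. u = cls f)"
proof
  have LB: "f \<in> polys_on L \<Longrightarrow> f \<in> polys_on B" for f using polys_on_mono L_subset_B by blast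
  assume "u \<in> Ugl_proper m0 m1 n"
  then have "u \<in> cls ` polys_on L"
    unfolding Ugl_proper_def
  proof (induction rule: generate_ring.induct)
    case one
    then show ?case by (auto simp: cls_one)
  next
    case (incl h)
    then show ?case by (auto simp: Uprod_def intro!: imageI polys_on_simps)
  next
    case (a_inv h)
    then show ?case by (auto simp: cls_uminus LB)
  next
    case (eng_add h1 h2)
    then show ?case by (auto simp: cls_add LB)
  next
    case (eng_mult h1 h2)
    then show ?case by (auto simp: cls_mult LB)
  qed
  then show "\<exists>f\<in>polys_on L. u = cls f" by blast
next
  have LB: "f \<in> polys_on L \<Longrightarrow> f \<in> polys_on B" for f using polys_on_mono L_subset_B by blast
  have const: "cls (const c) \<in> Ugl_proper m0 m1 n" for c
    unfolding Ugl_proper_def by (intro generate_ring.incl) auto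
  have word: "cls (word w) \<in> Ugl_proper m0 m1 n" if "set w \<subseteq> L" for w
    using that
  proof (induction w)
    case Nil
    then show ?case using const[of 1] by simp
  next
    case (Cons x w)
    then have "cls (word [x]) \<in> Ugl_proper m0 m1 n"
      unfolding Ugl_proper_def by (intro generate_ring.incl) (cases x, auto simp: Uprod_def)
    then have "cls (word [x]) \<otimes>\<^bsub>U\<^esub> cls (word w) \<in> Ugl_proper m0 m1 n"
      using Cons unfolding Ugl_proper_def by (intro generate_ring.eng_mult) auto
    moreover have "word [x] \<in> polys_on B" "word w \<in> polys_on B"
      by (intro polys_on_simps(8); use Cons.prems L_subset_B in auto)+
    ultimately show ?case by (simp add: cls_mult word_mult)
  qed
  assume "\<exists>f\<in>polys_on L. u = cls f"
  then obtain f where f: "f \<in> polys_on L" "u = cls f" by blast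
  have "f \<in> polys_on L \<and> cls f \<in> Ugl_proper m0 m1 n"
  proof (induction f rule: free_algebra_induct)
    case zero
    show ?case using const[of 0] by simp
  next
    case (single w c)
    then have w: "set w \<subseteq> L" using f(1) by (auto simp: polys_on_def)
    then have "cls (const c) \<otimes>\<^bsub>U\<^esub> cls (word w) \<in> Ugl_proper m0 m1 n"
      using const word unfolding Ugl_proper_def by (intro generate_ring.eng_mult) auto
    moreover have "word w \<in> polys_on L" using w by (rule polys_on_simps)
    ultimately show ?case by (simp add: cls_mult LB del: word_Nil)
  next
    case (add f g)
    then have "cls f \<oplus>\<^bsub>U\<^esub> cls g \<in> Ugl_proper m0 m1 n"
      unfolding Ugl_proper_def by (intro generate_ring.eng_add) auto
    then show ?case using add by (simp add: cls_add LB)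
  qed
  then show "u \<in> Ugl_proper m0 m1 n" using f by simp
qed

text \<open>The rule by which every projection is evaluated. The hypothesis gives membership in
  \<open>Virt\<close>, and uniqueness of the proper part comes from
  \<open>proper_in_J\<close>.\<close>

lemma vproj_eq:
  assumes "g \<in> polys_on L" "f - g \<in> J"
  shows "vproj m0 m1 n (cls f) = cls g"
proof -
  interpret U: ring U by (rule ring_Ugl)
  have g: "g \<in> polys_on B" using assms(1) polys_on_mono L_subset_B by blast
  have "f = (f - g) + g" by simp
  then have f: "f \<in> polys_on B" using g J_polys_on[OF assms(2)] polys_on_simps(4) by metis
  have gU: "cls g \<in> Ugl_proper m0 m1 n" using assms(1) Ugl_proper_iff by blast
  have "cls f = cls g \<oplus>\<^bsub>U\<^esub> cls (f - g)" using f g by (simp add: cls_add)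
  moreover have "cls (f - g) \<in> Irr m0 m1 n" using assms(2) by (simp add: J_def)
  ultimately have "cls f \<in> Virt m0 m1 n"
    using gU by (auto simp: Virt_def set_add_def')
  moreover have "(THE u. u \<in> Ugl_proper m0 m1 n \<and> cls f \<ominus>\<^bsub>U\<^esub> u \<in> Irr m0 m1 n) = cls g"
  proof (rule the_equality)
    show "cls g \<in> Ugl_proper m0 m1 n \<and> cls f \<ominus>\<^bsub>U\<^esub> cls g \<in> Irr m0 m1 n"
      using gU f g assms(2) by (simp add: cls_diff J_def)
  next
    fix u assume u: "u \<in> Ugl_proper m0 m1 n \<and> cls f \<ominus>\<^bsub>U\<^esub> u \<in> Irr m0 m1 n"
    then obtain h where h: "h \<in> polys_on L" "u = cls h" using Ugl_proper_iff by blast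
    then have hB: "h \<in> polys_on B" using polys_on_mono L_subset_B by blast
    have "f - h \<in> J" using u f hB h by (simp add: J_def cls_diff)
    from J_diff[OF assms(2) this] have "h - g \<in> J" by simp
    then have "h - g \<in> I" using h assms(1) by (intro proper_in_J) auto
    then show "u = cls g" using h hB g by (simp add: cls_eq_iff)
  qed
  ultimately show ?thesis by (simp add: vproj_def)
qed

end

section \<open>Contraction of virtual symbols\<close>

lemma parity_A1 [simp]: "\<beta> \<in> A1 m \<Longrightarrow> parity \<beta> = 1"
  by (auto simp: A1_def)

lemma parity_Lset [simp]: "a \<in> Lset m \<Longrightarrow> parity a = 1"
  by (auto simp: Lset_def)

lemma parity_A0 [simp]: "a \<in> A0 m \<Longrightarrow> parity a = 0"
  by (auto simp: A0_def)

lemma A1_Lset_disjoint: "\<beta> \<in> A1 m \<Longrightarrow> j \<in> Lset m' \<Longrightarrow> \<beta> \<noteq> j"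
  by (auto simp: A1_def Lset_def)

lemma set_zip_subset: "set xs \<subseteq> X \<Longrightarrow> set ys \<subseteq> Y \<Longrightarrow> set (zip xs ys) \<subseteq> X \<times> Y"
  by (auto dest: set_zip_leftD set_zip_rightD)

context enveloping
begin

lemma gl_basis_mem:
  "\<beta> \<in> A1 m1 \<Longrightarrow> j \<in> Lset n \<Longrightarrow> (\<beta>, j) \<in> B" "\<beta> \<in> A1 m1 \<Longrightarrow> j \<in> Lset n \<Longrightarrow> (j, \<beta>) \<in> B"
  "i \<in> Lset n \<Longrightarrow> j \<in> Lset n \<Longrightarrow> (i, j) \<in> B" "\<beta> \<in> A1 m1 \<Longrightarrow> (\<beta>, \<beta>) \<in> B"
  by (auto simp: gl_basis_def)

lemma commute_front:
  assumes "x \<in> B" "y \<in> B" "f \<in> polys_on B"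
  shows "word [x] * (word [y] * f) - (const (gl_sign x y) * (word [y] * (word [x] * f)) + gl_bracket x y * f) \<in> J"
proof -
  have "(word [x] * word [y] - const (gl_sign x y) * (word [y] * word [x]) - gl_bracket x y) * f \<in> I"
    using assms by (intro I_mult_right I_relation)
  then show ?thesis by (intro I_subset_J) (simp add: algebra_simps)
qed

lemma commute_past:
  assumes "x \<in> B" "set ys \<subseteq> B" "set p \<subseteq> B" "set q \<subseteq> B"
    and "\<And>y. y \<in> set ys \<Longrightarrow> gl_bracket x y = 0 \<and> gl_sign x y = - 1"
  shows "word (p @ x # ys @ q) - const ((- 1) ^ length ys) * word (p @ ys @ x # q) \<in> I"
  using assms(2,3,5)
proof (induction ys arbitrary: p)
  case (Cons y ys)
  have "word ((p @ [y]) @ x # ys @ q) - const ((- 1) ^ length ys) * word ((p @ [y]) @ ys @ x # q) \<in> I"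
    by (rule Cons.IH) (use Cons.prems in auto)
  then have 1: "const (- 1) * (word (p @ y # x # ys @ q) - const ((- 1) ^ length ys) * word (p @ y # ys @ x # q)) \<in> I"
    by (intro I_mult_left) auto
  have 2: "word (p @ x # y # ys @ q) - const (- 1) * word (p @ y # x # ys @ q) \<in> I"
    using word_swap[of x y p "ys @ q"] assms(1,4) Cons.prems by auto
  have "const ((- 1) ^ length (y # ys)) = const (- 1) * (const ((- 1) ^ length ys) :: fpoly)"
    by (simp add: mult_single plus_list_def)
  then show ?case
    using I_add[OF 1 2] by (simp add: right_diff_distrib mult.assoc)
qed (simp add: I_zero)

text \<open>This is \<open>(-1) ^ (k * (k - 1) div 2)\<close>, the sign of reversing
  \<open>k\<close> anticommuting factors; the product form suits induction on
  \<open>k\<close>.\<close>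

definition contraction_sign :: "nat \<Rightarrow> complex" where
  "contraction_sign k = (\<Prod>i<k. (- 1) ^ i)"

lemma contraction_sign_squared: "contraction_sign k * contraction_sign k = 1"
  by (simp add: contraction_sign_def flip: prod.distrib power_mult_distrib)

abbreviation "odd_symbs \<equiv> A1 m1 \<union> Lset n"

text \<open>The last annihilator anticommutes with the creators of the other virtual symbols, then
  meets its own creator and leaves \<open>e_{a,c}\<close> plus an irregular product. Disjointness of
  \<open>as\<close> and \<open>cs\<close> removes the remaining bracket terms. The new factor joins
  the tail, hence the general \<open>q\<close>, which must not create any \<open>Alpha\<close>
  symbol.\<close>

lemma contraction:
  assumes "length as = length \<gamma>s" "length cs = length \<gamma>s" "distinct \<gamma>s" "set \<gamma>s \<subseteq> A0 m0"
    "set as \<subseteq> odd_symbs" "set cs \<subseteq> odd_symbs" "set as \<inter> set cs = {}"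
    "set q \<subseteq> B" "fst ` set q \<inter> A0 m0 = {}"
  shows "word (zip as \<gamma>s @ zip \<gamma>s cs @ q) - const (contraction_sign (length \<gamma>s)) * word (zip as cs @ q) \<in> J"
  using assms
proof (induction \<gamma>s arbitrary: as cs q rule: rev_induct)
  case Nil
  then show ?case by (simp add: contraction_sign_def J_zero)
next
  case (snoc \<gamma> \<gamma>s)
  obtain as' a where as: "as = as' @ [a]" using snoc.prems(1) by (cases as rule: rev_cases) auto
  obtain cs' c where cs: "cs = cs' @ [c]" using snoc.prems(2) by (cases cs rule: rev_cases) auto
  have len: "length as' = length \<gamma>s" "length cs' = length \<gamma>s" using snoc.prems as cs by auto
  have \<gamma>: "\<gamma> \<in> A0 m0" "\<gamma> \<notin> set \<gamma>s" and ac: "a \<in> odd_symbs" "c \<in> odd_symbs" "a \<noteq> c"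
    using snoc.prems as cs by auto
  have dis: "\<gamma>' \<noteq> b" if "\<gamma>' \<in> A0 m0" "b \<in> odd_symbs" for \<gamma>' b
    using that by (auto simp: A0_def A1_def Lset_def)
  have par: "parity b = 1" if "b \<in> odd_symbs" for b using that by auto
  let ?k = "length \<gamma>s"
  let ?p = "zip as' \<gamma>s" and ?r = "zip \<gamma>s cs'"
  have pB: "set ?p \<subseteq> B" and rB: "set ?r \<subseteq> B"
    using snoc.prems as cs unfolding gl_basis_def by (intro set_zip_subset; auto)+
  have B: "(a, \<gamma>) \<in> B" "(\<gamma>, c) \<in> B" "(a, c) \<in> B"
    using \<gamma> ac by (auto simp: gl_basis_def)
  have "word (?p @ (a, \<gamma>) # ?r @ (\<gamma>, c) # q) - const ((- 1) ^ length ?r) * word (?p @ ?r @ (a, \<gamma>) # (\<gamma>, c) # q) \<in> I"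
  proof (rule commute_past)
    fix y assume "y \<in> set ?r"
    then have "fst y \<in> set \<gamma>s" "snd y \<in> set cs'"
      using set_zip_leftD[of "fst y" "snd y"] set_zip_rightD[of "fst y" "snd y"] by auto
    then have "fst y \<in> A0 m0" "snd y \<in> odd_symbs" "fst y \<noteq> \<gamma>" "snd y \<noteq> a"
      using snoc.prems as cs \<gamma> by auto
    then show "gl_bracket (a, \<gamma>) y = 0 \<and> gl_sign (a, \<gamma>) y = - 1"
      using \<gamma> ac by (auto simp: gl_bracket_def gl_sign_def par)
  qed (use B pB rB snoc.prems in auto)
  then have 1: "word (?p @ (a, \<gamma>) # ?r @ (\<gamma>, c) # q) - const ((- 1) ^ ?k) * word (?p @ ?r @ (a, \<gamma>) # (\<gamma>, c) # q) \<in> J"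
    using len by (auto intro: I_subset_J)
  have br: "gl_bracket (a, \<gamma>) (\<gamma>, c) = word [(a, c)]" "gl_sign (a, \<gamma>) (\<gamma>, c) = - 1"
    using ac \<gamma> by (auto simp: gl_bracket_def gl_sign_def par)
  have "word ((?p @ ?r) @ (a, \<gamma>) # (\<gamma>, c) # q) - const (- 1) * word ((?p @ ?r) @ (\<gamma>, c) # (a, \<gamma>) # q)
      - word (?p @ ?r) * word [(a, c)] * word q \<in> I"
    using word_swap[OF B(1,2), of "?p @ ?r" q] pB rB snoc.prems(8) unfolding br by auto
  then have 2: "word (?p @ ?r @ (a, \<gamma>) # (\<gamma>, c) # q) - const (- 1) * word (?p @ ?r @ (\<gamma>, c) # (a, \<gamma>) # q)
      - word (?p @ ?r @ (a, c) # q) \<in> J"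
    by (intro I_subset_J) (simp add: word_mult)
  have "word ((?p @ ?r @ [(\<gamma>, c)]) @ (a, \<gamma>) # q) \<in> J"
    using pB rB B snoc.prems(8,9) \<gamma> by (intro J_irregular) auto
  then have 3: "const (- 1) * word (?p @ ?r @ (\<gamma>, c) # (a, \<gamma>) # q) \<in> J"
    by (intro J_mult) auto
  have "word (?p @ ?r @ (a, c) # q) - const (contraction_sign ?k) * word (zip as' cs' @ (a, c) # q) \<in> J"
  proof (rule snoc.IH[OF len])
    show "fst ` set ((a, c) # q) \<inter> A0 m0 = {}" using snoc.prems(9) dis ac by auto
  qed (use snoc.prems as cs B in auto)
  from J_mult[OF J_add[OF J_add[OF 2 3] this], of "const ((- 1) ^ ?k)"]
  have 4: "const ((- 1) ^ ?k) * word (?p @ ?r @ (a, \<gamma>) # (\<gamma>, c) # q)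
      - const ((- 1) ^ ?k) * (const (contraction_sign ?k) * word (zip as' cs' @ (a, c) # q)) \<in> J"
    by (simp add: algebra_simps)
  \<comment> \<open>The sign from passing \<open>?k\<close> creators is the new last factor of
    \<open>contraction_sign\<close>.\<close>
  have 5: "const ((- 1) ^ ?k) * (const (contraction_sign ?k) * word (zip as' cs' @ (a, c) # q))
     = const (contraction_sign (length (\<gamma>s @ [\<gamma>]))) * word (zip as' cs' @ (a, c) # q)"
    by (simp add: mult_single plus_list_def contraction_sign_def mult.commute)
  show ?case
    using J_add[OF 1 4[unfolded 5]] len by (simp add: as cs)
qed

text \<open>\<open>virt_family k F\<close>: up to \<open>Irr\<close>, \<open>F \<beta>\<close> is a combination of products \<open>a e\<^sub>\<beta>\<^sub>,\<^sub>j\<^sub>1 \<dots> e\<^sub>\<beta>\<^sub>,\<^sub>j\<^sub>k\<close> with \<open>a\<close> proper, whose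
  coefficients do not depend on \<open>\<beta>\<close>. Carrying all \<open>\<beta>\<close> along at once is what makes the projections
  independent of \<open>\<beta>\<close>.\<close>

inductive virt_family :: "nat \<Rightarrow> (symb \<Rightarrow> fpoly) \<Rightarrow> bool" where
  base: "set js \<subseteq> Lset n \<Longrightarrow> virt_family (length js) (\<lambda>\<beta>. word (map (Pair \<beta>) js))"
| zero: "virt_family k (\<lambda>\<beta>. 0)"
| add: "virt_family k F \<Longrightarrow> virt_family k G \<Longrightarrow> virt_family k (\<lambda>\<beta>. F \<beta> + G \<beta>)"
| scale: "virt_family k F \<Longrightarrow> virt_family k (\<lambda>\<beta>. const c * F \<beta>)"
| mult: "virt_family k F \<Longrightarrow> i \<in> Lset n \<Longrightarrow> j \<in> Lset n \<Longrightarrow> virt_family k (\<lambda>\<beta>. word [(i, j)] * F \<beta>)"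
| congr: "virt_family k F \<Longrightarrow> (\<And>\<beta>. \<beta> \<in> A1 m1 \<Longrightarrow> G \<beta> - F \<beta> \<in> J) \<Longrightarrow> virt_family k G"

section \<open>Elimination of an odd virtual symbol\<close>

lemma virt_family_closed: "virt_family k F \<Longrightarrow> \<beta> \<in> A1 m1 \<Longrightarrow> F \<beta> \<in> polys_on B"
proof (induction rule: virt_family.induct)
  case (base js)
  then show ?case by (intro polys_on_simps(8)) (auto intro: gl_basis_mem)
next
  case (mult k F i j)
  then show ?case by (intro polys_on_simps(7,8)) (auto intro: gl_basis_mem)
next
  case (congr k F G)
  then have "G \<beta> - F \<beta> + F \<beta> \<in> polys_on B" by (intro polys_on_simps(4)) (auto simp: J_polys_on)
  then show ?case by simp
qed auto

lemma virt_family_J: "(\<And>\<beta>. \<beta> \<in> A1 m1 \<Longrightarrow> F \<beta> \<in> J) \<Longrightarrow> virt_family k F"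
  by (rule virt_family.congr[OF virt_family.zero]) simp

text \<open>A proper factor \<open>e_{i,l}\<close> in the way commutes with
  \<open>e_{\<beta>,j}\<close> up to the term \<open>e_{\<beta>,l}\<close> for \<open>i = j\<close>,
  again a creator of \<beta>, with a coefficient common to all \<beta>.\<close>

lemma virt_family_create: "virt_family k F \<Longrightarrow> j \<in> Lset n \<Longrightarrow> virt_family (Suc k) (\<lambda>\<beta>. word [(\<beta>, j)] * F \<beta>)"
proof (induction arbitrary: j rule: virt_family.induct)
  case (base js)
  then show ?case using virt_family.base[of "j # js"] by (simp add: word_mult)
next
  case (zero k)
  then show ?case by (simp add: virt_family.zero)
next
  case (add k F G)
  then show ?case using virt_family.add by (simp add: distrib_left)
next
  case (scale k F c)
  then show ?case using virt_family.scale by (simp add: const_left_commute)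
next
  case (mult k F i l)
  have "virt_family (Suc k) (\<lambda>\<beta>. word [(i, l)] * (word [(\<beta>, j)] * F \<beta>) + (if i = j then word [(\<beta>, l)] * F \<beta> else 0))"
    using mult by (intro virt_family.add virt_family.mult; cases "i = j") (auto intro: virt_family.zero)
  then show ?case
  proof (rule virt_family.congr)
    fix \<beta> assume \<beta>: "\<beta> \<in> A1 m1"
    have br: "gl_bracket (\<beta>, j) (i, l) = (if i = j then word [(\<beta>, l)] else 0)" "gl_sign (\<beta>, j) (i, l) = 1"
      using \<beta> mult.hyps(2,3) mult.prems A1_Lset_disjoint by (auto simp: gl_bracket_def gl_sign_def)
    have "word [(\<beta>, j)] * (word [(i, l)] * F \<beta>)
       - (const 1 * (word [(i, l)] * (word [(\<beta>, j)] * F \<beta>)) + (if i = j then word [(\<beta>, l)] else 0) * F \<beta>) \<in> J"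
      using commute_front[of "(\<beta>, j)" "(i, l)" "F \<beta>"] \<beta> mult.hyps(2,3) mult.prems virt_family_closed[OF mult.hyps(1) \<beta>]
      unfolding br by (simp add: gl_basis_mem)
    then show "word [(\<beta>, j)] * (word [(i, l)] * F \<beta>)
       - (word [(i, l)] * (word [(\<beta>, j)] * F \<beta>) + (if i = j then word [(\<beta>, l)] * F \<beta> else 0)) \<in> J"
      by (auto split: if_splits)
  qed
next
  case (congr k F G)
  show ?case
  proof (rule virt_family.congr[OF congr.IH[OF congr.prems]])
    fix \<beta> assume "\<beta> \<in> A1 m1"
    then have "word [(\<beta>, j)] * (G \<beta> - F \<beta>) \<in> J"
      using congr.hyps congr.prems by (intro J_mult polys_on_simps(8)) (auto simp: gl_basis_mem)
    then show "word [(\<beta>, j)] * G \<beta> - word [(\<beta>, j)] * F \<beta> \<in> J" by (simp add: right_diff_distrib)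
  qed
qed

text \<open>\<open>e_{\<beta>,\<beta>}\<close> is a number operator: each creator of \<beta> that it
  passes adds one, and on the empty product it is irregular.\<close>

lemma count_virtual:
  assumes "\<beta> \<in> A1 m1" "set js \<subseteq> Lset n"
  shows "word [(\<beta>, \<beta>)] * word (map (Pair \<beta>) js) - const (of_nat (length js)) * word (map (Pair \<beta>) js) \<in> J"
  using assms(2)
proof (induction js)
  case Nil
  then show ?case
    using J_irregular[of "[]" \<beta> \<beta> "[]"] assms(1) by (simp add: gl_basis_mem)
next
  case (Cons j js)
  let ?Q = "word (map (Pair \<beta>) js) :: fpoly"
  have j: "(\<beta>, j) \<in> B" using Cons.prems assms(1) by (auto intro: gl_basis_mem)
  have br: "gl_bracket (\<beta>, \<beta>) (\<beta>, j) = word [(\<beta>, j)]" "gl_sign (\<beta>, \<beta>) (\<beta>, j) = 1"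
    using assms(1) Cons.prems A1_Lset_disjoint by (auto simp: gl_bracket_def gl_sign_def)
  have "?Q \<in> polys_on B"
    using Cons.prems assms(1) by (intro polys_on_simps(8)) (auto intro: gl_basis_mem)
  then have 1: "word [(\<beta>, \<beta>)] * (word [(\<beta>, j)] * ?Q) - (word [(\<beta>, j)] * (word [(\<beta>, \<beta>)] * ?Q) + word [(\<beta>, j)] * ?Q) \<in> J"
    using commute_front[of "(\<beta>, \<beta>)" "(\<beta>, j)" ?Q] j assms(1) unfolding br by (simp add: gl_basis_mem)
  have 2: "word [(\<beta>, j)] * (word [(\<beta>, \<beta>)] * ?Q - const (of_nat (length js)) * ?Q) \<in> J"
    using Cons j by (intro J_mult polys_on_simps(8)) auto
  have "const (of_nat (length (j # js))) = 1 + (const (of_nat (length js)) :: fpoly)"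
    using single_add[of "[]" 1 "of_nat (length js) :: complex"] by simp
  then show ?case
    using J_add[OF 1 2] by (simp add: algebra_simps word_mult const_left_commute)
qed

text \<open>Moving \<open>e_{i,\<beta>}\<close> past \<open>e_{\<beta>,j}\<close> leaves
  \<open>e_{i,j}\<close> and, for \<open>i = j\<close>, also \<open>- e_{\<beta>,\<beta>}\<close>.
  The latter becomes a number by \<open>count_virtual\<close>, which keeps the coefficients
  independent of \<beta>.\<close>

lemma virt_family_annihilate_base:
  assumes "i \<in> Lset n" "set js \<subseteq> Lset n"
  shows "virt_family (length js - 1) (\<lambda>\<beta>. word [(i, \<beta>)] * word (map (Pair \<beta>) js))"
  using assms(2)
proof (induction js)
  case Nil
  show ?case
    using J_irregular[of "[]" i _ "[]"] assms(1) by (intro virt_family_J) (simp add: gl_basis_mem)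
next
  case (Cons j js)
  let ?Q = "\<lambda>\<beta>. word (map (Pair \<beta>) js) :: fpoly"
  let ?k = "length js"
  have "virt_family ?k (\<lambda>\<beta>. word [(\<beta>, j)] * (word [(i, \<beta>)] * ?Q \<beta>))"
  \<comment> \<open>For \<open>js = []\<close> truncated subtraction makes
    \<open>Suc (?k - 1)\<close> equal to 1 instead of 0, so \<open>virt_family_create\<close> would
    give the wrong index; there the product is itself irregular.\<close>
  proof (cases js)
    case Nil
    have "word [(\<beta>, j), (i, \<beta>)] \<in> J" if "\<beta> \<in> A1 m1" for \<beta>
      using J_irregular[of "[(\<beta>, j)]" i \<beta> "[]"] that assms(1) Cons.prems by (simp add: gl_basis_mem)
    then show ?thesis unfolding Nil by (intro virt_family_J) (simp add: word_mult)
  next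
    case (Cons j' js')
    have "virt_family (Suc (?k - 1)) (\<lambda>\<beta>. word [(\<beta>, j)] * (word [(i, \<beta>)] * ?Q \<beta>))"
      using Cons.IH Cons.prems by (intro virt_family_create) auto
    then show ?thesis using Cons by simp
  qed
  moreover have "virt_family ?k (\<lambda>\<beta>. word [(i, j)] * ?Q \<beta>)"
    using assms(1) Cons.prems by (intro virt_family.mult virt_family.base) auto
  moreover have "virt_family ?k (\<lambda>\<beta>. if i = j then const (- of_nat ?k) * ?Q \<beta> else 0)"
    using Cons.prems by (cases "i = j") (auto intro: virt_family.zero virt_family.scale virt_family.base)
  ultimately have "virt_family ?k (\<lambda>\<beta>. word [(\<beta>, j)] * (word [(i, \<beta>)] * ?Q \<beta>) + word [(i, j)] * ?Q \<beta>
      + (if i = j then const (- of_nat ?k) * ?Q \<beta> else 0))"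
    by (intro virt_family.add)
  then have "virt_family ?k (\<lambda>\<beta>. word [(i, \<beta>)] * (word [(\<beta>, j)] * ?Q \<beta>))"
  proof (rule virt_family.congr)
    fix \<beta> assume \<beta>: "\<beta> \<in> A1 m1"
    have j: "j \<in> Lset n" "set js \<subseteq> Lset n" using Cons.prems by auto
    have br: "gl_bracket (i, \<beta>) (\<beta>, j) = word [(i, j)] - (if i = j then word [(\<beta>, \<beta>)] else 0)" "gl_sign (i, \<beta>) (\<beta>, j) = 1"
      using assms(1) \<beta> j by (auto simp: gl_bracket_def gl_sign_def)
    have "?Q \<beta> \<in> polys_on B"
      using \<beta> j by (intro polys_on_simps(8)) (auto intro: gl_basis_mem)
    then have 1: "word [(i, \<beta>)] * (word [(\<beta>, j)] * ?Q \<beta>) - (word [(\<beta>, j)] * (word [(i, \<beta>)] * ?Q \<beta>)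
        + (word [(i, j)] - (if i = j then word [(\<beta>, \<beta>)] else 0)) * ?Q \<beta>) \<in> J"
      using commute_front[of "(i, \<beta>)" "(\<beta>, j)" "?Q \<beta>"] j assms(1) \<beta> unfolding br by (simp add: gl_basis_mem)
    have neg: "const (- c) = - (const c :: fpoly)" for c by (simp add: single_uminus)
    show "word [(i, \<beta>)] * (word [(\<beta>, j)] * ?Q \<beta>) - (word [(\<beta>, j)] * (word [(i, \<beta>)] * ?Q \<beta>) + word [(i, j)] * ?Q \<beta>
      + (if i = j then const (- of_nat ?k) * ?Q \<beta> else 0)) \<in> J"
      using 1 J_diff[OF 1 count_virtual[OF \<beta> j(2)]] by (cases "i = j") (simp_all add: algebra_simps neg)
  qed
  then show ?case by (simp add: word_mult)
qed

text \<open>The bracket of \<open>e_{i,\<beta>}\<close> with a proper \<open>e_{l,m}\<close> is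
  again an annihilator of \<beta>, namely \<open>- e_{l,\<beta>}\<close> for \<open>i = m\<close>,
  so the induction runs over all \<open>i\<close> at once.\<close>

lemma virt_family_annihilate: "virt_family k F \<Longrightarrow> i \<in> Lset n \<Longrightarrow> virt_family (k - 1) (\<lambda>\<beta>. word [(i, \<beta>)] * F \<beta>)"
proof (induction arbitrary: i rule: virt_family.induct)
  case (base js)
  then show ?case by (rule virt_family_annihilate_base[rotated])
next
  case (zero k)
  then show ?case by (simp add: virt_family.zero)
next
  case (add k F G)
  then show ?case using virt_family.add by (simp add: distrib_left)
next
  case (scale k F c)
  then show ?case using virt_family.scale by (simp add: const_left_commute)
next
  case (mult k F l m)
  have "virt_family (k - 1) (\<lambda>\<beta>. word [(l, m)] * (word [(i, \<beta>)] * F \<beta>) + (if i = m then const (- 1) * (word [(l, \<beta>)] * F \<beta>) else 0))"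
    using mult by (intro virt_family.add virt_family.mult; cases "i = m") (auto intro: virt_family.zero virt_family.scale)
  then show ?case
  proof (rule virt_family.congr)
    fix \<beta> assume \<beta>: "\<beta> \<in> A1 m1"
    have br: "gl_bracket (i, \<beta>) (l, m) = (if i = m then const (- 1) * word [(l, \<beta>)] else 0)" "gl_sign (i, \<beta>) (l, m) = 1"
      using \<beta> mult.hyps(2,3) mult.prems A1_Lset_disjoint
      by (auto simp: gl_bracket_def gl_sign_def const_mult_single single_uminus)
    have "word [(i, \<beta>)] * (word [(l, m)] * F \<beta>)
       - (const 1 * (word [(l, m)] * (word [(i, \<beta>)] * F \<beta>)) + (if i = m then const (- 1) * word [(l, \<beta>)] else 0) * F \<beta>) \<in> J"
      using commute_front[of "(i, \<beta>)" "(l, m)" "F \<beta>"] \<beta> mult.hyps(2,3) mult.prems virt_family_closed[OF mult.hyps(1) \<beta>]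
      unfolding br by (simp add: gl_basis_mem)
    then show "word [(i, \<beta>)] * (word [(l, m)] * F \<beta>)
       - (word [(l, m)] * (word [(i, \<beta>)] * F \<beta>) + (if i = m then const (- 1) * (word [(l, \<beta>)] * F \<beta>) else 0)) \<in> J"
      by (auto simp: mult.assoc split: if_splits)
  qed
next
  case (congr k F G)
  show ?case
  proof (rule virt_family.congr[OF congr.IH[OF congr.prems]])
    fix \<beta> assume "\<beta> \<in> A1 m1"
    then have "word [(i, \<beta>)] * (G \<beta> - F \<beta>) \<in> J"
      using congr.hyps congr.prems by (intro J_mult polys_on_simps(8)) (auto simp: gl_basis_mem)
    then show "word [(i, \<beta>)] * G \<beta> - word [(i, \<beta>)] * F \<beta> \<in> J" by (simp add: right_diff_distrib)
  qed
qed

lemma virt_family_proper: "virt_family k F \<Longrightarrow> k = 0 \<Longrightarrow> \<exists>u\<in>polys_on L. \<forall>\<beta>\<in>A1 m1. F \<beta> - u \<in> J"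
proof (induction rule: virt_family.induct)
  case (base js)
  then show ?case by (intro bexI[of _ 1]) (auto intro: J_zero)
next
  case (zero k)
  then show ?case by (intro bexI[of _ 0]) (auto intro: J_zero)
next
  case (add k F G)
  then obtain u v where "u \<in> polys_on L" "v \<in> polys_on L" "\<forall>\<beta>\<in>A1 m1. F \<beta> - u \<in> J" "\<forall>\<beta>\<in>A1 m1. G \<beta> - v \<in> J"
    by blast
  moreover have "F \<beta> + G \<beta> - (u + v) = (F \<beta> - u) + (G \<beta> - v)" for \<beta> by simp
  ultimately show ?case
    by (intro bexI[of _ "u + v"] ballI) (metis J_add, rule polys_on_simps)
next
  case (scale k F c)
  then obtain u where "u \<in> polys_on L" "\<forall>\<beta>\<in>A1 m1. F \<beta> - u \<in> J" by blast
  then show ?case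
    by (intro bexI[of _ "const c * u"] ballI)
      (simp_all add: J_mult polys_on_simps flip: right_diff_distrib)
next
  case (mult k F i j)
  then obtain u where u: "u \<in> polys_on L" "\<forall>\<beta>\<in>A1 m1. F \<beta> - u \<in> J" by blast
  have w: "word [(i, j)] \<in> polys_on B" "word [(i, j)] \<in> polys_on L"
    using mult.hyps(2,3) by (intro polys_on_simps(8); simp add: gl_basis_mem)+
  with u show ?case
    by (intro bexI[of _ "word [(i, j)] * u"] ballI)
      (simp_all add: J_mult polys_on_simps flip: right_diff_distrib)
next
  case (congr k F G)
  then obtain u where u: "u \<in> polys_on L" "\<forall>\<beta>\<in>A1 m1. F \<beta> - u \<in> J" by blast
  show ?case
  proof (intro bexI[OF _ u(1)] ballI)
    fix \<beta> assume "\<beta> \<in> A1 m1"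
    then show "G \<beta> - u \<in> J" using J_add[OF congr.hyps(2), of \<beta> "F \<beta> - u"] u(2) by simp
  qed
qed

lemma virt_family_annihilate_list:
  "virt_family k F \<Longrightarrow> set is \<subseteq> Lset n \<Longrightarrow> virt_family (k - length is) (\<lambda>\<beta>. word (map (\<lambda>i. (i, \<beta>)) is) * F \<beta>)"
proof (induction "is")
  case (Cons i "is")
  then have "virt_family (k - length is - 1) (\<lambda>\<beta>. word [(i, \<beta>)] * (word (map (\<lambda>i. (i, \<beta>)) is) * F \<beta>))"
    by (intro virt_family_annihilate) auto
  then show ?case by (simp add: word_mult flip: mult.assoc)
qed simp

text \<open>Each annihilator lowers the index by one, so equal lengths end at index 0, where no
  creator is left. The resulting \<open>u\<close> is the projection of the product, the same for
  every \<beta>.\<close>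

lemma devirtualize:
  assumes "set is \<subseteq> Lset n" "set js \<subseteq> Lset n" "length is = length js"
  obtains u where "u \<in> polys_on L"
    "\<And>\<beta>. \<beta> \<in> A1 m1 \<Longrightarrow> word (map (\<lambda>i. (i, \<beta>)) is @ map (Pair \<beta>) js) - u \<in> J"
  using virt_family_proper[OF virt_family_annihilate_list[OF virt_family.base[OF assms(2)] assms(1)]] assms(3)
  by (auto simp: word_mult)

section \<open>Rearranging the factors on either side of the middle\<close>

lemma permute_commuting:
  assumes "mset s = mset t" "f ` set s \<subseteq> B"
    and "\<And>x y. x \<in> set s \<Longrightarrow> y \<in> set s \<Longrightarrow> gl_bracket (f x) (f y) = 0 \<and> gl_sign (f x) (f y) = 1"
  shows "word (map f s) - word (map f t) \<in> I"
proof (rule mset_eq_adjacent_swaps[where M = "mset s" and P = "\<lambda>u w. word (map f u) - word (map f w) \<in> I"])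
  show "word (map f u) - word (map f v) \<in> I"
    if "word (map f u) - word (map f w) \<in> I" "word (map f w) - word (map f v) \<in> I" for u w v
    using I_add[OF that] by simp
next
  fix p x y q assume m: "mset (p @ x # y # q) = mset s"
  then have "set (p @ x # y # q) = set s" by (rule mset_eq_setD)
  then have xy: "x \<in> set s" "y \<in> set s" "set p \<subseteq> set s" "set q \<subseteq> set s" by auto
  have "word (map f p @ f x # f y # map f q) - const (gl_sign (f x) (f y)) * word (map f p @ f y # f x # map f q)
      - word (map f p) * gl_bracket (f x) (f y) * word (map f q) \<in> I"
    by (rule word_swap) (use xy assms(2) in auto)
  then show "word (map f (p @ x # y # q)) - word (map f (p @ y # x # q)) \<in> I"
    using assms(3)[OF xy(1,2)] by simp
qed (use assms in \<open>auto intro: I_zero\<close>)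

lemma permute_virtual:
  assumes "\<beta> \<in> A1 m1" "set s \<subseteq> Lset n" "mset s = mset t" "mset s = mset t'"
  shows "word (map (\<lambda>i. (i, \<beta>)) s @ map (Pair \<beta>) s) - word (map (\<lambda>i. (i, \<beta>)) t @ map (Pair \<beta>) t') \<in> J"
proof -
  let ?P = "\<lambda>s. word (map (\<lambda>i. (i, \<beta>)) s) :: fpoly" and ?Q = "\<lambda>s. word (map (Pair \<beta>) s) :: fpoly"
  have \<beta>: "x \<noteq> \<beta>" "(x, \<beta>) \<in> B" "(\<beta>, x) \<in> B" "parity x = 1" if "x \<in> set s" for x
    using that assms(2) A1_Lset_disjoint[OF assms(1), of x n] by (auto simp: gl_basis_mem assms(1))
  have "?P s - ?P t \<in> I"
    by (rule permute_commuting[OF assms(3)]) (use assms(1) \<beta> in \<open>auto simp: gl_bracket_def gl_sign_def\<close>)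
  \<comment> \<open>Here the left block changes in front of a right factor, which the two-sided
    \<open>I\<close> permits and \<open>J\<close> would not.\<close>
  then have 1: "(?P s - ?P t) * ?Q s \<in> I"
    by (rule I_mult_right) (use \<beta> in \<open>auto intro!: polys_on_simps(8)\<close>)
  have "?Q s - ?Q t' \<in> I"
    by (rule permute_commuting[OF assms(4)]) (use assms(1) \<beta> in \<open>auto simp: gl_bracket_def gl_sign_def\<close>)
  then have 2: "?P t * (?Q s - ?Q t') \<in> I"
    by (rule I_mult_left) (use \<beta> mset_eq_setD[OF assms(3)] in \<open>auto intro!: polys_on_simps(8)\<close>)
  show ?thesis
    using I_subset_J[OF I_add[OF 1 2]] by (simp add: algebra_simps word_mult)
qed

end

section \<open>Column tableaux and contents\<close>

text \<open>The list \<open>l\<close> fixes the order of the blocks, because the products in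
  \<open>I_elem\<close> run through the letters downwards on the left and upwards on the
  right.\<close>

definition word_of_content :: "nat list \<Rightarrow> nat list \<Rightarrow> nat list" where
  "word_of_content h l = concat (map (\<lambda>i. replicate (h ! (i - 1)) i) l)"

definition content :: "nat \<Rightarrow> nat list \<Rightarrow> nat list" where
  "content n s = map (count (mset s)) [1..<n + 1]"

lemma count_word_of_content:
  "distinct l \<Longrightarrow> count (mset (word_of_content h l)) i = (if i \<in> set l then h ! (i - 1) else 0)"
  by (induction l) (auto simp: word_of_content_def)

lemma mset_word_of_content_rev: "mset (word_of_content h (rev [1..<n + 1])) = mset (word_of_content h [1..<n + 1])"
  by (rule multiset_eqI) (subst (1 2) count_word_of_content, auto)

lemma set_word_of_content: "set (word_of_content h l) \<subseteq> set l"
  by (auto simp: word_of_content_def)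

lemma map_nth_minus_one: "length h = n \<Longrightarrow> map (\<lambda>i. h ! (i - 1)) [1..<n + 1] = h"
  by (rule nth_equalityI) (auto simp del: upt_Suc)

lemma length_word_of_content: "length h = n \<Longrightarrow> length (word_of_content h [1..<n + 1]) = sum_list h"
  using arg_cong[OF map_nth_minus_one, of h n sum_list] by (simp add: word_of_content_def length_concat o_def del: upt_Suc)

lemma content_eq_iff:
  assumes "set s \<subseteq> {1..n}" "length h = n"
  shows "content n s = h \<longleftrightarrow> mset s = mset (word_of_content h [1..<n + 1])"
proof
  have c: "count (mset (word_of_content h [1..<n + 1])) i = (if i \<in> {1..n} then h ! (i - 1) else 0)" for i
    by (subst count_word_of_content) (auto simp del: upt_Suc)
  assume "content n s = h"
  then have h: "h = map (count (mset s)) [1..<n + 1]" by (simp add: content_def)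
  have "count (mset s) i = (if i \<in> {1..n} then h ! (i - 1) else 0)" for i
    using assms(1) unfolding h by (auto simp: not_in_iff[symmetric] subset_iff simp del: upt_Suc)
  then show "mset s = mset (word_of_content h [1..<n + 1])"
    by (intro multiset_eqI) (simp only: c)
next
  assume "mset s = mset (word_of_content h [1..<n + 1])"
  then have "content n s = map (\<lambda>i. h ! (i - 1)) [1..<n + 1]"
    unfolding content_def by (auto simp: count_word_of_content simp del: upt_Suc)
  then show "content n s = h" using map_nth_minus_one[OF assms(2)] by simp
qed

text \<open>The multinomial coefficient: the sequences with content \<open>h\<close> are the
  permutations of one multiset.\<close>

lemma card_content_fibre:
  assumes "length h = n" "sum_list h = k"
  shows "of_nat (card {s. length s = k \<and> set s \<subseteq> {1..n} \<and> content n s = h}) * (\<Prod>i = 1..n. fact (h ! (i - 1)))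
    = (fact k :: complex)"
proof -
  let ?M = "mset (word_of_content h [1..<n + 1])"
  have "{s. length s = k \<and> set s \<subseteq> {1..n} \<and> content n s = h} = permutations_of_multiset ?M"
  proof (intro equalityI subsetI)
    fix s assume "s \<in> permutations_of_multiset ?M"
    then have s: "mset s = ?M" by (simp add: permutations_of_multiset_def)
    then have "set s \<subseteq> {1..n}"
      using set_word_of_content[of h "[1..<n + 1]"] mset_eq_setD[OF s] by (auto simp del: upt_Suc)
    moreover have "length s = k"
      using mset_eq_length[OF s] length_word_of_content[OF assms(1)] assms(2) by simp
    ultimately show "s \<in> {s. length s = k \<and> set s \<subseteq> {1..n} \<and> content n s = h}"
      using content_eq_iff[OF _ assms(1), of s] s by simp
  next
    fix s assume "s \<in> {s. length s = k \<and> set s \<subseteq> {1..n} \<and> content n s = h}"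
    then show "s \<in> permutations_of_multiset ?M"
      using content_eq_iff[OF _ assms(1), of s] by (simp add: permutations_of_multiset_def)
  qed
  moreover have "(\<Prod>x\<in>set_mset ?M. fact (count ?M x)) = (\<Prod>i = 1..n. fact (h ! (i - 1)) :: nat)"
  proof -
    have "(\<Prod>x\<in>set_mset ?M. fact (count ?M x)) = (\<Prod>x\<in>{1..n}. fact (count ?M x) :: nat)"
      using set_word_of_content[of h "[1..<n + 1]"]
      by (intro prod.mono_neutral_left) (auto simp: count_mset_0_iff[THEN iffD2] simp del: upt_Suc)
    also have "\<dots> = (\<Prod>i = 1..n. fact (h ! (i - 1)))"
      by (intro prod.cong refl arg_cong[of _ _ fact], subst count_word_of_content) (auto simp del: upt_Suc)
    finally show ?thesis .
  qed
  moreover have "size ?M = k"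
    using length_word_of_content[OF assms(1)] assms(2) by (simp only: size_mset)
  ultimately have "card {s. length s = k \<and> set s \<subseteq> {1..n} \<and> content n s = h} * (\<Prod>i = 1..n. fact (h ! (i - 1))) = fact k"
    using card_permutations_of_multiset[of ?M] by (simp del: upt_Suc)
  from arg_cong[OF this, of "of_nat :: nat \<Rightarrow> complex"] show ?thesis by simp
qed

lemma finite_contents: "finite {h :: nat list. length h = n \<and> sum_list h = k}"
proof (rule finite_subset)
  show "{h. length h = n \<and> sum_list h = k} \<subseteq> {h. set h \<subseteq> {..k} \<and> length h = n}"
    by (auto simp: member_le_sum_list)
qed (rule finite_lists_length_eq, simp)

section \<open>Tableaux of column shape\<close>

text \<open>Rows of length one are strictly increasing automatically, and nothing relates entries of
  different rows, so every sequence occurs.\<close>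

lemma row_strict_tableaux_column:
  "row_strict_tableaux n (replicate k 1) = map (\<lambda>i. [i]) ` {s. length s = k \<and> set s \<subseteq> {1..n}}"
proof (intro equalityI subsetI)
  fix T assume T: "T \<in> row_strict_tableaux n (replicate k 1)"
  then have len: "map length T = replicate k 1" and rows: "\<And>row. row \<in> set T \<Longrightarrow> set row \<subseteq> {1..n}"
    by (auto simp: row_strict_tableaux_def)
  have "length row = 1" if "row \<in> set T" for row
    using that arg_cong[OF len, of set] by auto
  then have single: "[hd row] = row" if "row \<in> set T" for row
    using that by (metis One_nat_def length_0_conv length_Suc_conv list.sel(1))
  then have "map (\<lambda>i. [i]) (map hd T) = T"
    by (auto intro!: map_idI)
  moreover have "length (map hd T) = k" using arg_cong[OF len, of length] by simp
  moreover have "set (map hd T) \<subseteq> {1..n}"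
  proof
    fix i assume "i \<in> set (map hd T)"
    then obtain row where row: "row \<in> set T" "i = hd row" by auto
    then have "i \<in> set row" using single[of row] by (metis list.set_intros(1))
    then show "i \<in> {1..n}" using rows row by blast
  qed
  ultimately show "T \<in> map (\<lambda>i. [i]) ` {s. length s = k \<and> set s \<subseteq> {1..n}}"
    by (metis (mono_tags, lifting) imageI mem_Collect_eq)
next
  fix T assume "T \<in> map (\<lambda>i. [i]) ` {s. length s = k \<and> set s \<subseteq> {1..n}}"
  then show "T \<in> row_strict_tableaux n (replicate k 1)"
    by (auto simp: row_strict_tableaux_def map_replicate_const o_def subset_iff)
qed

text \<open>In row \<open>i\<close>, counted from 0, the arm is empty and the hook length is
  \<open>k - i\<close>.\<close>

lemma hook_product_column: "hook_product (replicate k 1) = fact k"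
proof -
  have "hook_product (replicate k 1) = (\<Prod>i<k. k - i)"
    unfolding hook_product_def
  proof (intro prod.cong)
    fix i assume i: "i \<in> {..<k}"
    have "{r. r < k \<and> 0 < replicate k (1 :: nat) ! r} = {..<k}" by auto
    then show "(\<Prod>j<replicate k 1 ! i. hook_length (replicate k 1) i j) = k - i"
      using i by (simp add: hook_length_def)
  qed simp
  also have "\<dots> = fact k"
    by (simp add: fact_prod_rev atLeast0LessThan)
  finally show ?thesis .
qed

lemma concat_C_star_column: "concat (C_star (replicate k 1)) = map (\<lambda>i. Alpha (i + 1)) [0..<k]"
proof -
  have "C_star (replicate k 1) = map (\<lambda>i. [Alpha (i + 1)]) [0..<k]"
    by (auto simp: C_star_def)
  then show ?thesis by simp
qed

lemma concat_D_star_column: "concat (D_star (replicate k 1)) = replicate k (Beta 1)"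
  by (induction k) (auto simp: D_star_def)

lemma zip_replicate_right: "length s = k \<Longrightarrow> zip s (replicate k b) = map (\<lambda>i. (i, b)) s"
  by (simp add: zip_replicate2)

lemma zip_replicate_left: "length s = k \<Longrightarrow> zip (replicate k b) s = map (Pair b) s"
  by (simp add: zip_replicate1)

context enveloping
begin

text \<open>The right half is contracted first, behind a left factor, as \<open>J\<close> allows;
  only then is the tail of the left half free of creators of \<open>Alpha\<close> symbols, as
  \<open>contraction\<close> demands. Both contractions have the sign
  \<open>contraction_sign k\<close>, whose square is 1.\<close>

lemma contract_column:
  assumes "k \<le> m0" "length s = k" "set s \<subseteq> {1..n}" "\<beta> \<in> A1 m1"
  defines "S \<equiv> map Letter s" and "C \<equiv> map (\<lambda>i. Alpha (i + 1)) [0..<k]" and "D \<equiv> replicate k \<beta>"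
  shows "word (zip S C @ zip C D @ zip D C @ zip C S) - word (map (\<lambda>i. (i, \<beta>)) S @ map (Pair \<beta>) S) \<in> J"
proof -
  let ?c = "const (contraction_sign k) :: fpoly"
  have len: "length S = k" "length C = k" "length D = k" by (simp_all add: S_def C_def D_def assms)
  have S: "set S \<subseteq> Lset n" using assms(3) by (auto simp: S_def Lset_def)
  have C: "set C \<subseteq> A0 m0" "distinct C" using assms(1) by (auto simp: C_def A0_def distinct_map inj_on_def)
  have D: "set D \<subseteq> {\<beta>}" by (auto simp: D_def)
  have dis: "set S \<inter> set D = {}" using S D A1_Lset_disjoint[OF assms(4)] by auto
  have \<beta>: "\<beta> \<notin> A0 m0" using assms(4) by (auto simp: A0_def A1_def)
  have "word (zip D C @ zip C S @ []) - const (contraction_sign (length C)) * word (zip D S @ []) \<in> J"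
    by (rule contraction) (use len C S D dis assms(4) in auto)
  then have 1: "word (zip D C @ zip C S) - ?c * word (zip D S) \<in> J" by (simp add: len)
  have "set (zip S C @ zip C D) \<subseteq> B"
    using set_zip_subset[OF S C(1)] set_zip_subset[OF C(1) D] assms(4) by (auto simp: gl_basis_def)
  then have "word (zip S C @ zip C D) * (word (zip D C @ zip C S) - ?c * word (zip D S)) \<in> J"
    by (intro J_mult 1 polys_on_simps(8))
  then have 2: "word (zip S C @ zip C D @ zip D C @ zip C S) - ?c * word (zip S C @ zip C D @ zip D S) \<in> J"
    by (simp add: right_diff_distrib word_mult const_left_commute)
  have q: "set (zip D S) \<subseteq> {\<beta>} \<times> Lset n" by (rule set_zip_subset[OF D S])
  then have "word (zip S C @ zip C D @ zip D S) - const (contraction_sign (length C)) * word (zip S D @ zip D S) \<in> J"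
    by (intro contraction) (use len C S D dis \<beta> assms(4) in \<open>auto simp: gl_basis_def\<close>)
  then have "?c * (word (zip S C @ zip C D @ zip D S) - ?c * word (zip S D @ zip D S)) \<in> J"
    unfolding len by (intro J_mult) auto
  then have 3: "?c * word (zip S C @ zip C D @ zip D S) - word (zip S D @ zip D S) \<in> J"
    by (simp add: right_diff_distrib const_mult_single contraction_sign_squared flip: mult.assoc)
  show ?thesis
    using J_add[OF 2 3] by (simp add: D_def zip_replicate_left zip_replicate_right len)
qed

lemma column_product:
  assumes "k \<le> m0" "length s = k" "set s \<subseteq> {1..n}" "\<beta> \<in> A1 m1"
    and "u \<in> polys_on L" "word (map (\<lambda>i. (i, \<beta>)) (map Letter s) @ map (Pair \<beta>) (map Letter s)) - u \<in> J"
  defines "S \<equiv> map Letter s" and "C \<equiv> map (\<lambda>i. Alpha (i + 1)) [0..<k]" and "D \<equiv> replicate k \<beta>"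
  shows "vproj m0 m1 n (Uprod m0 m1 n (zip S C) \<otimes>\<^bsub>U\<^esub> Uprod m0 m1 n (zip C D) \<otimes>\<^bsub>U\<^esub> Uprod m0 m1 n (zip D C) \<otimes>\<^bsub>U\<^esub> Uprod m0 m1 n (zip C S)) = cls u"
proof -
  have S: "set S \<subseteq> Lset n" using assms(3) by (auto simp: S_def Lset_def)
  have C: "set C \<subseteq> A0 m0" using assms(1) by (auto simp: C_def A0_def)
  have D: "set D \<subseteq> A1 m1" using assms(4) by (auto simp: D_def)
  have "word (zip S C) \<in> polys_on B" "word (zip C D) \<in> polys_on B" "word (zip D C) \<in> polys_on B" "word (zip C S) \<in> polys_on B"
    using set_zip_subset[OF S C] set_zip_subset[OF C D] set_zip_subset[OF D C] set_zip_subset[OF C S]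
    by (intro polys_on_simps(8); auto simp: gl_basis_def)+
  then have "Uprod m0 m1 n (zip S C) \<otimes>\<^bsub>U\<^esub> Uprod m0 m1 n (zip C D) \<otimes>\<^bsub>U\<^esub> Uprod m0 m1 n (zip D C) \<otimes>\<^bsub>U\<^esub> Uprod m0 m1 n (zip C S)
      = cls (word (zip S C) * word (zip C D) * word (zip D C) * word (zip C S))"
    unfolding Uprod_def by (simp add: cls_mult)
  also have "word (zip S C) * word (zip C D) * word (zip D C) * word (zip C S) = (word (zip S C @ zip C D @ zip D C @ zip C S) :: fpoly)"
    by (simp add: word_mult)
  also have "vproj m0 m1 n (cls \<dots>) = cls u"
    using J_add[OF contract_column[OF assms(1-4)] assms(6)]
    by (intro vproj_eq assms(5)) (simp add: S_def C_def D_def)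
  finally show ?thesis .
qed

section \<open>Comparison of the two sums\<close>

text \<open>One \<open>u h\<close> per content, common to all \<beta>, serves both
  \<open>Beta 1\<close> in the tableau sum and the given \<beta> in \<open>I_elem\<close>.\<close>

lemma content_values:
  obtains u where "\<And>h. length h = n \<Longrightarrow> u h \<in> polys_on L"
    "\<And>h \<beta>. length h = n \<Longrightarrow> \<beta> \<in> A1 m1 \<Longrightarrow>
      word (map (\<lambda>i. (i, \<beta>)) (map Letter (word_of_content h (rev [1..<n + 1])))
        @ map (Pair \<beta>) (map Letter (word_of_content h [1..<n + 1]))) - u h \<in> J"
proof -
  have "\<exists>u. u \<in> polys_on L \<and> (\<forall>\<beta>\<in>A1 m1. word (map (\<lambda>i. (i, \<beta>)) (map Letter (word_of_content h (rev [1..<n + 1])))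
        @ map (Pair \<beta>) (map Letter (word_of_content h [1..<n + 1]))) - u \<in> J)" for h
  proof -
    let ?s = "map Letter (word_of_content h (rev [1..<n + 1]))" and ?t = "map Letter (word_of_content h [1..<n + 1])"
    have "set ?s \<subseteq> Lset n" "set ?t \<subseteq> Lset n"
      using set_word_of_content[of h "rev [1..<n + 1]"] set_word_of_content[of h "[1..<n + 1]"]
      unfolding Lset_def set_map by (intro image_mono; auto simp del: upt_Suc)+
    moreover have "length ?s = length ?t"
      using mset_eq_length[OF mset_word_of_content_rev] by (simp del: upt_Suc)
    ultimately show ?thesis by (rule devirtualize) blast
  qed
  then obtain u where "\<And>h. u h \<in> polys_on L \<and> (\<forall>\<beta>\<in>A1 m1. word (map (\<lambda>i. (i, \<beta>)) (map Letter (word_of_content h (rev [1..<n + 1])))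
        @ map (Pair \<beta>) (map Letter (word_of_content h [1..<n + 1]))) - u h \<in> J)"
    by metis
  then show thesis by (intro that[of u]) blast+
qed

lemma S_elem_column_eq_I_elem:
  assumes "k \<le> m0" "\<beta> \<in> A1 m1"
  shows "S_elem m0 m1 n (replicate k 1) = I_elem m0 m1 n \<beta> k"
proof -
  interpret U: ring U by (rule ring_Ugl)
  obtain u where u: "\<And>h. length h = n \<Longrightarrow> u h \<in> polys_on L"
    and uJ: "\<And>h \<beta>. length h = n \<Longrightarrow> \<beta> \<in> A1 m1 \<Longrightarrow>
      word (map (\<lambda>i. (i, \<beta>)) (map Letter (word_of_content h (rev [1..<n + 1])))
        @ map (Pair \<beta>) (map Letter (word_of_content h [1..<n + 1]))) - u h \<in> J"
    by (rule content_values) (rule that; blast)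
  have uB: "u h \<in> polys_on B" if "length h = n" for h
    using u[OF that] polys_on_mono L_subset_B by blast
  let ?H = "{h :: nat list. length h = n \<and> sum_list h = k}"
  let ?s = "{s :: nat list. length s = k \<and> set s \<subseteq> {1..n}}"
  let ?pf = "\<lambda>h. (\<Prod>i = 1..n. fact (h ! (i - 1))) :: complex"
  \<comment> \<open>\<open>D_star\<close> of a column contains only \<open>Beta 1\<close>, which is
    available because \<beta> makes \<open>A1 m1\<close> nonempty.\<close>
  have \<beta>1: "Beta 1 \<in> A1 m1" using assms(2) by (auto simp: A1_def)
  have content: "length (content n s) = n" for s by (simp add: content_def)
  have content_H: "content n s \<in> ?H" if "s \<in> ?s" for s
    using that content_eq_iff[of s n "content n s"] content mset_eq_length[of s "word_of_content (content n s) [1..<n + 1]"]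
      length_word_of_content[of "content n s" n] by (simp del: upt_Suc)
  have fin_s: "finite ?s"
    using finite_lists_length_eq[of "{1..n}" k] by (simp add: conj_commute)
  have S_summand: "vproj m0 m1 n
             (Uprod m0 m1 n (tab_word (map (map Letter) T) (C_star (replicate k 1))) \<otimes>\<^bsub>U\<^esub> Uprod m0 m1 n (tab_word (C_star (replicate k 1)) (D_star (replicate k 1)))
              \<otimes>\<^bsub>U\<^esub> Uprod m0 m1 n (tab_word (D_star (replicate k 1)) (C_star (replicate k 1))) \<otimes>\<^bsub>U\<^esub> Uprod m0 m1 n (tab_word (C_star (replicate k 1)) (map (map Letter) T)))
      = cls (u (content n (concat T)))" if "T \<in> row_strict_tableaux n (replicate k 1)" for T
  proof -
    obtain s where s: "T = map (\<lambda>i. [i]) s" "length s = k" "set s \<subseteq> {1..n}"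
      using \<open>T \<in> _\<close> unfolding row_strict_tableaux_column by auto
    let ?h = "content n s"
    have "mset s = mset (word_of_content ?h [1..<n + 1])"
      using content_eq_iff[OF s(3) content] by blast
    then have m: "mset (map Letter s) = mset (map Letter (word_of_content ?h [1..<n + 1]))"
      "mset (map Letter s) = mset (map Letter (word_of_content ?h (rev [1..<n + 1])))"
      using mset_word_of_content_rev by (simp_all del: upt_Suc)
    have "set (map Letter s) \<subseteq> Lset n" using s(3) by (auto simp: Lset_def)
    \<comment> \<open>Both blocks are sorted, the left one downwards and the right one upwards, to
      reach the product for which \<open>u\<close> was chosen.\<close>
    from J_add[OF permute_virtual[OF \<beta>1 this m(2,1)] uJ[OF content[of s] \<beta>1]]
    have "word (map (\<lambda>i. (i, Beta 1)) (map Letter s) @ map (Pair (Beta 1)) (map Letter s)) - u ?h \<in> J"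
      by (simp del: upt_Suc)
    from column_product[OF assms(1) s(2,3) \<beta>1 u[OF content] this]
    show ?thesis
      unfolding tab_word_def concat_C_star_column concat_D_star_column
      by (simp add: s(1) o_def concat_map_singleton)
  qed
  have I_summand: "vproj m0 m1 n
            (Uprod m0 m1 n
              (concat (map (\<lambda>i. replicate (h ! (i - 1)) (Letter i, \<beta>)) (rev [1..<n + 1]))
               @ concat (map (\<lambda>i. replicate (h ! (i - 1)) (\<beta>, Letter i)) [1..<n + 1]))) = cls (u h)" if "h \<in> ?H" for h
    using vproj_eq[OF u uJ[OF _ assms(2)], of h] that
    by (simp add: Uprod_def word_of_content_def map_concat o_def del: upt_Suc)
  have "S_elem m0 m1 n (replicate k 1) = Uscale m0 m1 n (1 / fact k)
      (\<Oplus>\<^bsub>U\<^esub>T\<in>row_strict_tableaux n (replicate k 1). cls (u (content n (concat T))))"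
    unfolding S_elem_def hook_product_column Let_def of_nat_fact
    by (intro arg_cong2[of _ _ _ _ "Uscale m0 m1 n"] U.finsum_cong' S_summand)
      (auto intro: cls_closed uB content)
  also have "(\<Oplus>\<^bsub>U\<^esub>T\<in>row_strict_tableaux n (replicate k 1). cls (u (content n (concat T))))
      = cls (\<Sum>T\<in>row_strict_tableaux n (replicate k 1). u (content n (concat T)))"
    using fin_s unfolding row_strict_tableaux_column by (intro cls_sum) (auto intro: uB content)
  also have "(\<Sum>T\<in>row_strict_tableaux n (replicate k 1). u (content n (concat T))) = (\<Sum>s\<in>?s. u (content n s))"
    unfolding row_strict_tableaux_column
    by (subst sum.reindex) (auto simp: inj_on_def map_eq_conv concat_map_singleton o_def dest: map_injective)
  \<comment> \<open>The summand depends on \<open>s\<close> through its content only, so equal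
    contents are grouped.\<close>
  also have "\<dots> = (\<Sum>h\<in>?H. \<Sum>s\<in>{s \<in> ?s. content n s = h}. u (content n s))"
    using fin_s finite_contents content_H by (intro sum.group[symmetric]) auto
  also have "\<dots> = (\<Sum>h\<in>?H. const (of_nat (card {s. length s = k \<and> set s \<subseteq> {1..n} \<and> content n s = h})) * u h)"
  proof (rule sum.cong)
    fix h assume "h \<in> ?H"
    have "{s \<in> ?s. content n s = h} = {s. length s = k \<and> set s \<subseteq> {1..n} \<and> content n s = h}" by auto
    then show "(\<Sum>s\<in>{s \<in> ?s. content n s = h}. u (content n s))
        = const (of_nat (card {s. length s = k \<and> set s \<subseteq> {1..n} \<and> content n s = h})) * u h"
      by (simp add: of_nat_single zero_list_def)
  qed simp
  \<comment> \<open>The hook product \<open>k!\<close> cancels the numerator of the multinomial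
    coefficient and leaves the weights of \<open>I_elem\<close>.\<close>
  also have "Uscale m0 m1 n (1 / fact k) (cls \<dots>) = cls (\<Sum>h\<in>?H. const (1 / ?pf h) * u h)"
  proof (subst Uscale_cls)
    have "const (1 / fact k) * (const (of_nat (card {s. length s = k \<and> set s \<subseteq> {1..n} \<and> content n s = h})) * u h)
        = const (1 / ?pf h) * u h" if "h \<in> ?H" for h
    proof -
      have "1 / fact k * of_nat (card {s. length s = k \<and> set s \<subseteq> {1..n} \<and> content n s = h}) = 1 / ?pf h"
        using card_content_fibre[of h n k] that by (auto simp: field_simps)
      then show ?thesis by (simp add: const_mult_single flip: mult.assoc)
    qed
    then show "cls (const (1 / fact k) * (\<Sum>h\<in>?H. const (of_nat (card {s. length s = k \<and> set s \<subseteq> {1..n} \<and> content n s = h})) * u h))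
       = cls (\<Sum>h\<in>?H. const (1 / ?pf h) * u h)"
      by (simp add: sum_distrib_left)
  qed (intro polys_on_sum polys_on_simps(3,7) uB; simp)
  also have "\<dots> = (\<Oplus>\<^bsub>U\<^esub>h\<in>?H. cls (const (1 / ?pf h) * u h))"
    by (intro cls_sum[symmetric] finite_contents polys_on_simps(3,7) uB; simp)
  also have "\<dots> = I_elem m0 m1 n \<beta> k"
    unfolding I_elem_def
  proof (rule U.finsum_cong'[symmetric, OF refl])
    show "(\<lambda>h. cls (const (1 / ?pf h) * u h)) \<in> ?H \<rightarrow> carrier U"
      by (intro Pi_I cls_closed polys_on_simps(3,7) uB; simp)
  next
    fix h assume h: "h \<in> ?H"
    then show "Uscale m0 m1 n (1 / ?pf h) (vproj m0 m1 n
            (Uprod m0 m1 n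
              (concat (map (\<lambda>i. replicate (h ! (i - 1)) (Letter i, \<beta>)) (rev [1..<n + 1]))
               @ concat (map (\<lambda>i. replicate (h ! (i - 1)) (\<beta>, Letter i)) [1..<n + 1])))) = cls (const (1 / ?pf h) * u h)"
      unfolding I_summand[OF h] by (intro Uscale_cls uB) simp
  qed
  finally show ?thesis .
qed

end

theorem proposition4p55:
  fixes m0 m1 n k :: nat and \<beta> :: symb
  assumes "n \<ge> 1" and "k \<ge> 1"
    and "m0 \<ge> k" and "\<beta> \<in> A1 m1"
  shows "S_elem m0 m1 n (replicate k 1) = I_elem m0 m1 n \<beta> k"
  using enveloping.S_elem_column_eq_I_elem assms(3,4) .

end
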